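(* Let $\mu$ be a centered probability measure on $\mathbb{R}^d$ with finite second moments, and let $\{\lambda_i\}_{i=1}^d$ be the eigenvalues of its covariance matrix $\mathrm{Cov}(\mu)$, counted with multiplicity. Then $$\delta_{\mathrm{Tal}}(\mu)\;\geq\;\sum_{i=1}^d\frac{2(1-\lambda_i)+(\lambda_i+1)\log(\lambda_i)}{\lambda_i-1}\,\mathbf{1}_{\{\lambda_i<1\}}.$$
   Context: $\gamma$ is the standard Gaussian measure on $\mathbb{R}^d$. The relative entropy of probability measures is $\mathrm{D}(\mu||\nu)=\int\ln\left(\frac{d\mu}{d\nu}\right)d\mu$, with value $+\infty$ if $\mu$ is not absolutely continuous with respect to $\nu$. The quadratic Wasserstein distance is $\mathcal{W}_2(\mu,\gamma)=\left(\inf_\pi\int_{\mathbb{R}^{2d}}\|x-y\|_2^2\,d\pi(x,y)\right)^{1/2}$, the infimum being over couplings $\pi$ of $\mu$ and $\gamma$. The deficit in Talagrand's inequality is $\delta_{\mathrm{Tal}}(\mu)=2\mathrm{D}(\mu||\gamma)-\mathcal{W}_2^2(\mu,\gamma)$ (equal to $+\infty$ if $\mathrm{D}(\mu||\gamma)=\infty$). Centered means $\int x\,d\mu(x)=0$. $\log$ is the natural logarithm. Terms with $\lambda_i\geq 1$ are zero, and a term with $\lambda_i=0$ is read as $+\infty$ (in that case $\mathrm{D}(\mu||\gamma)=\infty$). *)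

theory Defs
  imports
    "HOL-Probability.Probability"
    "HOL-Computational_Algebra.Polynomial"
begin

definition std_gaussian :: "(real ^ 'd) measure" where
  "std_gaussian = density lborel (\<lambda>x. ennreal (\<Prod>i\<in>UNIV. std_normal_density (x $ i)))"

(* KL_divergence b N M is the Bochner integral of log b (dM/dN) with respect to M, which is 0
   when that function is not integrable.  For probability measures with M absolutely continuous
   with respect to N the negative part is always integrable (rel_entropy_neg_part below), so
   non-integrability means that the integral is +infinity. *)
definition rel_entropy :: "'a measure \<Rightarrow> 'a measure \<Rightarrow> ereal" where
  "rel_entropy M N =
     (if absolutely_continuous N M \<and> integrable M (entropy_density (exp 1) N M)
      then ereal (KL_divergence (exp 1) N M) else \<infinity>)"

lemma rel_entropy_neg_part:
  assumes M: "prob_space M" and N: "prob_space N"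
    and sets: "sets M = sets N" and ac: "absolutely_continuous N M"
  shows "(\<integral>\<^sup>+ x. ennreal (- entropy_density (exp 1) N M x) \<partial>M) \<le> 1"
proof -
  interpret M: prob_space M by fact
  interpret N: prob_space N by fact
  have dens: "density N (RN_deriv N M) = M"
    using ac sets by (rule N.density_RN_deriv)
  have "(\<integral>\<^sup>+ x. ennreal (- entropy_density (exp 1) N M x) \<partial>M)
      = (\<integral>\<^sup>+ x. ennreal (- entropy_density (exp 1) N M x) \<partial>(density N (RN_deriv N M)))"
    by (simp only: dens)
  also have "\<dots> = (\<integral>\<^sup>+ x. RN_deriv N M x * ennreal (- entropy_density (exp 1) N M x) \<partial>N)"
    by (rule nn_integral_density) measurable
  also have "\<dots> \<le> (\<integral>\<^sup>+ x. 1 \<partial>N)"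
  proof (rule nn_integral_mono)
    fix x
    show "RN_deriv N M x * ennreal (- entropy_density (exp 1) N M x) \<le> 1"
    proof (cases "RN_deriv N M x")
      case (real r)
      have "r * - ln r \<le> 1"
      proof (cases "r = 0")
        case False
        then have "ln (1 / r) \<le> 1 / r - 1"
          using real by (intro ln_le_minus_one) simp
        then have "r * - ln r \<le> r * (1 / r - 1)"
          using real False by (intro mult_left_mono) (simp_all add: ln_div)
        then show ?thesis
          using real False by (simp add: right_diff_distrib)
      qed simp
      then show ?thesis
        using real
        by (simp add: entropy_density_def log_def flip: ennreal_mult' ennreal_1)
    qed (simp add: entropy_density_def log_def)
  qed
  also have "\<dots> = 1"
    by (simp add: N.emeasure_space_1)
  finally show ?thesis .
qed

definition couplings :: "'a measure \<Rightarrow> 'b measure \<Rightarrow> ('a \<times> 'b) measure set" where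
  "couplings M N =
     {P. prob_space P \<and> sets P = sets (M \<Otimes>\<^sub>M N) \<and> distr P M fst = M \<and> distr P N snd = N}"

definition transport_cost ::
    "'a::real_normed_vector measure \<Rightarrow> 'a measure \<Rightarrow> ennreal" where
  "transport_cost M N = (INF P\<in>couplings M N. \<integral>\<^sup>+ (x, y). ennreal ((norm (x - y))\<^sup>2) \<partial>P)"

definition wasserstein2 :: "'a::real_normed_vector measure \<Rightarrow> 'a measure \<Rightarrow> ereal" where
  "wasserstein2 M N =
     (if transport_cost M N = \<infinity> then \<infinity> else ereal (sqrt (enn2real (transport_cost M N))))"

(* In ereal, \<infinity> - x = \<infinity> for every x, so the deficit is \<infinity> whenever the relative entropy is. *)
definition talagrand_deficit :: "(real ^ 'd) measure \<Rightarrow> ereal" where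
  "talagrand_deficit M = 2 * rel_entropy M std_gaussian - (wasserstein2 M std_gaussian)\<^sup>2"

definition mean :: "(real ^ 'd) measure \<Rightarrow> real ^ 'd" where
  "mean M = (\<integral>x. x \<partial>M)"

definition covariance_matrix :: "(real ^ 'd) measure \<Rightarrow> real ^ 'd ^ 'd" where
  "covariance_matrix M =
     (\<chi> i j. \<integral>x. (x $ i - mean M $ i) * (x $ j - mean M $ j) \<partial>M)"

definition char_polynomial :: "'a::comm_ring_1 ^ 'd ^ 'd \<Rightarrow> 'a poly" where
  "char_polynomial A = det (mat [:0, 1:] - (\<chi> i j. [:A $ i $ j:]))"

(* l enumerates the eigenvalues of A with multiplicity, in an arbitrary order; the coordinate
   type 'd serves as an index set with as many elements as the dimension. *)
definition eigenvalue_enumeration :: "'a::comm_ring_1 ^ 'd ^ 'd \<Rightarrow> ('d \<Rightarrow> 'a) \<Rightarrow> bool" where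
  "eigenvalue_enumeration A l \<longleftrightarrow> char_polynomial A = (\<Prod>i\<in>UNIV. [:- l i, 1:])"

(* The term is read as \<infinity> at l = 0, its limit from the right.  Eigenvalues of a covariance
   matrix are nonnegative, so l < 0 does not occur. *)
definition deficit_term :: "real \<Rightarrow> ereal" where
  "deficit_term l =
     (if l < 1
      then (if l = 0 then \<infinity> else ereal ((2 * (1 - l) + (l + 1) * ln l) / (l - 1)))
      else 0)"

end

theory Submission
  imports Defs
begin

text \<open>Write \<open>X\<close> for a random vector with law \<open>\<mu>\<close>, in an orthonormal eigenbasis of the covariance matrix.
  The triangular (Knothe--Rosenblatt) map \<open>S\<close>, which applies to each coordinate the monotone transport of its
  conditional law given the previous coordinates, pushes \<open>\<mu>\<close> to the Gaussian measure, so
  \<open>(X, S X)\<close> is a coupling of cost \<open>\<Sum>\<^sub>i (\<lambda>\<^sub>i + 1 - 2 a\<^sub>i)\<close>, where \<open>a\<^sub>i = E [X\<^sub>i S\<^sub>i]\<close>.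
  In dimension one, \<open>\<phi>\<close> denoting the Gaussian density and \<open>p\<close> the density of \<open>X\<close>, the function
  \<open>\<phi> (S x) = E [S; X > x]\<close> has Lebesgue integral \<open>a = E [X S]\<close>; Gibbs' inequality for \<open>p\<close>
  against it bounds the entropy from below by \<open>(\<lambda> - 1) / 2 - ln a\<close>, and
  the chain rule for the entropy adds up these bounds. The logarithm is linearised at a free parameter \<open>c\<^sub>i\<close>,
  which makes all terms integrable. Together this gives
  \<open>\<delta> \<ge> 2 \<Sum>\<^sub>i (a\<^sub>i (1 - 1 / c\<^sub>i) - ln c\<^sub>i)\<close> for all \<open>c\<close>. Since \<open>a\<^sub>i \<le> sqrt \<lambda>\<^sub>i\<close> by Cauchy--Schwarz,
  taking \<open>c\<^sub>i = min 1 (sqrt \<lambda>\<^sub>i)\<close> bounds the deficit below by the sum of \<open>2 sqrt \<lambda>\<^sub>i - 2 - ln \<lambda>\<^sub>i\<close> over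
  \<open>\<lambda>\<^sub>i < 1\<close>, which is the deficit of a Gaussian and dominates the claimed bound.\<close>

section \<open>The standard Gaussian on the line and monotone transport towards it\<close>

definition gauss1 :: "real measure" where
  "gauss1 = density lborel (\<lambda>x. ennreal (std_normal_density x))"

lemma sets_gauss1 [simp, measurable_cong]: "sets gauss1 = sets borel"
  by (simp add: gauss1_def)

lemma space_gauss1 [simp]: "space gauss1 = UNIV"
  by (simp add: gauss1_def)

lemma prob_space_gauss1: "prob_space gauss1"
  unfolding gauss1_def by (rule prob_space_normal_density) simp

lemma real_distribution_gauss1: "real_distribution gauss1"
  by (simp add: prob_space_gauss1 real_distribution_axioms_def real_distribution_def)

interpretation gauss1: cdf_distribution gauss1
  by (simp add: cdf_distribution_def real_distribution_gauss1)

lemma AE_gauss1: "(AE x in gauss1. P x) \<longleftrightarrow> (AE x in lborel. P x)"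
  unfolding gauss1_def by (subst AE_density) (simp_all add: normal_density_pos)

lemma measure_gauss1_singleton: "measure gauss1 {x} = 0"
proof -
  have "AE y in gauss1. y \<noteq> x"
    unfolding AE_gauss1 by (rule AE_lborel_singleton)
  then show ?thesis
    by (subst gauss1.prob_eq_0) auto
qed

lemma integrable_gauss1_iff:
  assumes [measurable]: "f \<in> borel_measurable borel"
  shows "integrable gauss1 f \<longleftrightarrow> integrable lborel (\<lambda>x. std_normal_density x * f x :: real)"
  unfolding gauss1_def by (subst integrable_density) auto

lemma integral_gauss1:
  assumes [measurable]: "f \<in> borel_measurable borel"
  shows "(\<integral>x. f x \<partial>gauss1) = (\<integral>x. std_normal_density x * f x \<partial>lborel :: real)"
  unfolding gauss1_def by (subst integral_density) auto

lemma gauss1_first_moment: "integrable gauss1 (\<lambda>x. x)" "(\<integral>x. x \<partial>gauss1) = 0"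
  using integrable_std_normal_moment[of 1] integral_std_normal_moment_odd[of 0]
  by (simp_all add: integrable_gauss1_iff integral_gauss1)

lemma gauss1_second_moment: "integrable gauss1 (\<lambda>x. x\<^sup>2)" "(\<integral>x. x\<^sup>2 \<partial>gauss1) = 1"
  using integrable_std_normal_moment[of 2] integral_std_normal_moment_even[of 1]
  by (simp_all add: integrable_gauss1_iff integral_gauss1)

text \<open>An antiderivative of \<open>std_normal_density x * x\<close> is
  \<open>- std_normal_density x\<close>, which vanishes at infinity. This is how the Gaussian
  density arises as a tail expectation.\<close>

lemma gauss1_tail_moment: "(\<integral>x. x * indicator {z<..} x \<partial>gauss1) = std_normal_density z"
proof -
  have int: "integrable lborel (\<lambda>x. std_normal_density x * x)"
    using integrable_std_normal_moment[of 1] by simp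
  have lim: "((\<lambda>x. - std_normal_density x) \<longlongrightarrow> 0) at_top"
    unfolding std_normal_density_def by real_asymp
  have "(\<integral>x. x * indicator {z<..} x \<partial>gauss1) = (LBINT x=ereal z..\<infinity>. std_normal_density x * x)"
    by (subst integral_gauss1)
      (auto simp: interval_lebesgue_integral_def set_lebesgue_integral_def einterval_def
        intro!: Bochner_Integration.integral_cong split: split_indicator)
  also have "\<dots> = 0 - (- std_normal_density z)"
  proof (rule interval_integral_FTC_integrable)
    fix x :: real
    show "((\<lambda>x. - std_normal_density x) has_vector_derivative std_normal_density x * x) (at x)"
      unfolding std_normal_density_def has_real_derivative_iff_has_vector_derivative[symmetric]
      by (auto intro!: derivative_eq_intros simp: real_div_sqrt field_simps)
    show "isCont (\<lambda>x. std_normal_density x * x) x"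
      unfolding std_normal_density_def by (intro continuous_intros) auto
  next
    show "set_integrable lborel (einterval (ereal z) \<infinity>) (\<lambda>x. std_normal_density x * x)"
      unfolding set_integrable_def using integrable_mult_indicator[OF _ int, of "einterval (ereal z) \<infinity>"] by simp
  next
    have "isCont (\<lambda>x. - std_normal_density x) z"
      unfolding std_normal_density_def by (intro continuous_intros) auto
    then show "(((\<lambda>x. - std_normal_density x) \<circ> real_of_ereal) \<longlongrightarrow> - std_normal_density z) (at_right (ereal z))"
      by (auto simp only: ereal_tendsto_simps isCont_def filterlim_at_split)
    show "(((\<lambda>x. - std_normal_density x) \<circ> real_of_ereal) \<longlongrightarrow> 0) (at_left \<infinity>)"
      using lim by (simp only: ereal_tendsto_simps)
  qed simp
  finally show ?thesis by simp
qed

text \<open>The inverse \<open>gauss1.I\<close> of the distribution function is meaningful only on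
  the open unit interval; the value 0 elsewhere makes the function total and Borel
  measurable.\<close>

definition gauss_quantile :: "real \<Rightarrow> real" where
  "gauss_quantile u = (if 0 < u \<and> u < 1 then gauss1.I u else 0)"

lemma measurable_gauss_quantile [measurable]: "gauss_quantile \<in> borel_measurable borel"
proof -
  have "(\<lambda>u. if u \<in> {0<..<1} then gauss1.I u else 0) \<in> borel_measurable borel"
    using gauss1.measurable_CI
    by (subst measurable_If_restrict_space_iff) (auto simp del: greaterThanLessThan_iff)
  then show ?thesis
    by (simp add: gauss_quantile_def[abs_def])
qed

abbreviation uniform01 :: "real measure" where
  "uniform01 \<equiv> restrict_space lborel {0<..<1}"

lemma measurable_uniform01_quantile [measurable]: "gauss_quantile \<in> borel_measurable uniform01"
  by (intro measurable_restrict_space1) simp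

lemma distr_gauss_quantile: "distr uniform01 borel gauss_quantile = gauss1"
  by (subst gauss1.distr_I_eq_M[symmetric], rule distr_cong)
    (auto simp: gauss_quantile_def space_restrict_space)

section \<open>Monotone transport of an atomless distribution to the Gaussian\<close>

locale atomless_distribution = cdf_distribution +
  assumes atomless: "\<And>x. measure M {x} = 0"
begin

lemma measurable_uniform01_I [measurable]: "I \<in> borel_measurable uniform01"
  using measurable_CI by (simp cong: measurable_cong_sets)

text \<open>Without atoms \<open>C\<close> is also left continuous. An overshoot
  \<open>\<omega> < C (I \<omega>)\<close> would persist slightly to the left of
  \<open>I \<omega>\<close>, against the equivalence \<open>pseudoinverse\<close>.\<close>

lemma C_I: assumes "0 < \<omega>" "\<omega> < 1" shows "C (I \<omega>) = \<omega>"
proof (rule antisym)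
  show "\<omega> \<le> C (I \<omega>)"
    using pseudoinverse[OF assms] by blast
  show "C (I \<omega>) \<le> \<omega>"
  proof (rule ccontr)
    assume "\<not> C (I \<omega>) \<le> \<omega>"
    then have less: "\<omega> < C (I \<omega>)" by simp
    have "isCont C (I \<omega>)"
      by (simp add: isCont_cdf atomless)
    then have "(C \<longlongrightarrow> C (I \<omega>)) (at_left (I \<omega>))"
      by (simp add: isCont_def filterlim_at_split)
    then have "\<forall>\<^sub>F x in at_left (I \<omega>). \<omega> < C x"
      using less by (rule order_tendstoD)
    moreover have "\<forall>\<^sub>F x in at_left (I \<omega>). x < I \<omega>"
      by (simp add: eventually_at_filter)
    ultimately have "\<forall>\<^sub>F x in at_left (I \<omega>). False"
      by eventually_elim (metis pseudoinverse[OF assms] less_imp_le not_le)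
    then show False by simp
  qed
qed

text \<open>Quantile function of the target after the distribution function of the source: the
  monotone transport map, which is \<open>S\<close> of the introduction in dimension one.\<close>

definition to_gauss :: "real \<Rightarrow> real" where
  "to_gauss y = gauss_quantile (C y)"

lemma measurable_to_gauss [measurable]: "to_gauss \<in> borel_measurable borel"
  unfolding to_gauss_def[abs_def] by measurable

lemma to_gauss_I: "\<omega> \<in> {0<..<1} \<Longrightarrow> to_gauss (I \<omega>) = gauss_quantile \<omega>"
  by (simp add: to_gauss_def C_I)

lemma distr_to_gauss: "distr M borel to_gauss = gauss1"
proof -
  have "distr M borel to_gauss = distr uniform01 borel (to_gauss \<circ> I)"
    by (subst distr_I_eq_M[symmetric], subst distr_distr) auto
  also have "\<dots> = distr uniform01 borel gauss_quantile"
    by (rule distr_cong) (auto simp: space_restrict_space to_gauss_I)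
  finally show ?thesis
    by (simp add: distr_gauss_quantile)
qed

lemma integrable_to_gauss: "integrable M to_gauss" "integrable M (\<lambda>y. (to_gauss y)\<^sup>2)"
  "(\<integral>y. to_gauss y \<partial>M) = 0" "(\<integral>y. (to_gauss y)\<^sup>2 \<partial>M) = 1"
proof -
  show "integrable M to_gauss"
    using gauss1_first_moment(1) by (simp flip: distr_to_gauss add: integrable_distr_eq)
  show "integrable M (\<lambda>y. (to_gauss y)\<^sup>2)"
    using gauss1_second_moment(1) by (simp flip: distr_to_gauss add: integrable_distr_eq)
  show "(\<integral>y. to_gauss y \<partial>M) = 0"
    using gauss1_first_moment(2) by (simp flip: distr_to_gauss add: integral_distr)
  show "(\<integral>y. (to_gauss y)\<^sup>2 \<partial>M) = 1"
    using gauss1_second_moment(2) by (simp flip: distr_to_gauss add: integral_distr)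
qed

text \<open>This is \<open>E [S; Y > y]\<close> for \<open>Y\<close> of law \<open>M\<close> and
  \<open>S = to_gauss Y\<close>. Rescaled, it is the comparison density in Gibbs' inequality. In
  this form, rather than as the Gaussian density at \<open>to_gauss y\<close>, its Lebesgue integral
  is accessible to Fubini.\<close>

definition tail :: "real \<Rightarrow> real" where
  "tail y = (\<integral>w. to_gauss w * indicator {y<..} w \<partial>M)"

text \<open>Representing \<open>M\<close> as the law of \<open>I\<close> under the uniform measure
  turns the event \<open>y < w\<close> into \<open>C y < \<omega>\<close>, so the tail depends on
  \<open>y\<close> only through \<open>C y\<close>.\<close>

lemma tail_eq_uniform: "tail y = (\<integral>\<omega>. gauss_quantile \<omega> * indicator {C y<..} \<omega> \<partial>uniform01)"
proof -
  have "tail y = (\<integral>\<omega>. to_gauss (I \<omega>) * indicator {y<..} (I \<omega>) \<partial>uniform01)"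
    unfolding tail_def by (subst distr_I_eq_M[symmetric], subst integral_distr) auto
  also have "\<dots> = (\<integral>\<omega>. gauss_quantile \<omega> * indicator {C y<..} \<omega> \<partial>uniform01)"
  proof (rule Bochner_Integration.integral_cong)
    fix \<omega> assume "\<omega> \<in> space uniform01"
    then have w: "\<omega> \<in> {0<..<1}" by (simp add: space_restrict_space)
    then have "\<omega> \<le> C y \<longleftrightarrow> I \<omega> \<le> y"
      by (intro pseudoinverse) auto
    then show "to_gauss (I \<omega>) * indicator {y<..} (I \<omega>) = gauss_quantile \<omega> * indicator {C y<..} \<omega>"
      using w by (auto simp: to_gauss_I split: split_indicator)
  qed simp
  finally show ?thesis .
qed

lemma tail_eq:
  assumes "0 < C y" "C y < 1"
  shows "tail y = std_normal_density (to_gauss y)"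
proof -
  have "tail y = (\<integral>\<omega>. gauss_quantile \<omega> * indicator {to_gauss y<..} (gauss_quantile \<omega>) \<partial>uniform01)"
    unfolding tail_eq_uniform
  proof (rule Bochner_Integration.integral_cong)
    fix \<omega> assume "\<omega> \<in> space uniform01"
    then have w: "0 < \<omega>" "\<omega> < 1" by (simp_all add: space_restrict_space)
    interpret G: atomless_distribution gauss1
      by unfold_locales (rule measure_gauss1_singleton)
    \<comment> \<open>The Gaussian has no atoms either, so its quantile function is strictly
      increasing on the unit interval and the condition \<open>C y < \<omega>\<close> can be read
      off the quantiles.\<close>
    have "\<omega> \<le> C y \<longleftrightarrow> gauss1.I \<omega> \<le> gauss1.I (C y)"
      using gauss1.pseudoinverse[OF w, of "gauss1.I (C y)"] G.C_I[OF assms] by simp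
    then show "gauss_quantile \<omega> * indicator {C y<..} \<omega> =
      gauss_quantile \<omega> * indicator {to_gauss y<..} (gauss_quantile \<omega>)"
      using w assms by (auto simp: to_gauss_def gauss_quantile_def split: split_indicator)
  qed simp
  also have "\<dots> = (\<integral>x. x * indicator {to_gauss y<..} x \<partial>gauss1)"
    unfolding distr_gauss_quantile[symmetric] by (subst integral_distr) auto
  finally show ?thesis by (simp add: gauss1_tail_moment)
qed

text \<open>Outside the range of \<open>tail_eq\<close> the tail vanishes: at \<open>C y = 0\<close>
  it is the Gaussian mean, at \<open>C y = 1\<close> an integral over an empty set. Nonnegativity at
  every \<open>y\<close> is used later at points where the density of the law is zero.\<close>

lemma tail_nonneg: "0 \<le> tail y"
proof -
  consider "C y = 0" | "C y = 1" | "0 < C y" "C y < 1"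
    using cdf_nonneg[of y] cdf_bounded_prob[of y] by linarith
  then show ?thesis
  proof cases
    case 1
    have "tail y = (\<integral>\<omega>. gauss_quantile \<omega> \<partial>uniform01)"
      unfolding tail_eq_uniform 1
      by (rule Bochner_Integration.integral_cong) (auto simp: space_restrict_space)
    also have "\<dots> = (\<integral>x. x \<partial>gauss1)"
      by (subst distr_gauss_quantile[symmetric], subst integral_distr) auto
    finally show ?thesis by (simp add: gauss1_first_moment)
  next
    case 2
    have "tail y = (\<integral>\<omega>. 0 \<partial>uniform01)"
      unfolding tail_eq_uniform 2
      by (rule Bochner_Integration.integral_cong) (auto simp: space_restrict_space)
    then show ?thesis by simp
  qed (simp add: tail_eq)
qed

text \<open>In the quantile representation \<open>C (I \<omega>) = \<omega>\<close> lies strictly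
  between 0 and 1, so \<open>tail_eq\<close> applies almost surely.\<close>

lemma AE_tail_eq: "AE y in M. tail y = std_normal_density (to_gauss y)"
proof -
  have "AE \<omega> in uniform01. 0 < C (I \<omega>) \<and> C (I \<omega>) < 1"
    by (rule AE_I2) (simp add: space_restrict_space C_I)
  then have "AE y in distr uniform01 borel I. 0 < C y \<and> C y < 1"
    by (subst AE_distr_iff) auto
  then have "AE y in M. 0 < C y \<and> C y < 1"
    unfolding distr_I_eq_M .
  then show ?thesis
    by eventually_elim (simp add: tail_eq)
qed

lemma integrable_id_to_gauss:
  assumes "integrable M (\<lambda>y. y\<^sup>2)"
  shows "integrable M (\<lambda>y. y * to_gauss y)"
proof (rule Bochner_Integration.integrable_bound)
  show "(\<lambda>y. y * to_gauss y) \<in> borel_measurable M"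
    by measurable
  show "integrable M (\<lambda>y. y\<^sup>2 + (to_gauss y)\<^sup>2)"
    by (rule Bochner_Integration.integrable_add[OF assms integrable_to_gauss(2)])
  show "AE y in M. norm (y * to_gauss y) \<le> norm (y\<^sup>2 + (to_gauss y)\<^sup>2)"
  proof (rule AE_I2)
    fix y
    have "2 * (\<bar>y\<bar> * \<bar>to_gauss y\<bar>) \<le> y\<^sup>2 + (to_gauss y)\<^sup>2"
      using sum_squares_bound[of "\<bar>y\<bar>" "\<bar>to_gauss y\<bar>"] by simp
    moreover have "0 \<le> \<bar>y\<bar> * \<bar>to_gauss y\<bar>" by simp
    ultimately have "\<bar>y\<bar> * \<bar>to_gauss y\<bar> \<le> y\<^sup>2 + (to_gauss y)\<^sup>2"
      by linarith
    then show "norm (y * to_gauss y) \<le> norm (y\<^sup>2 + (to_gauss y)\<^sup>2)"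
      by (simp add: abs_mult)
  qed
qed

text \<open>Layer-cake formula: integrating \<open>E [S; Y > y]\<close> over \<open>y\<close> and
  exchanging the integrals produces the signed length of the interval from 0 to \<open>Y\<close>,
  hence \<open>E [Y S]\<close>.\<close>

lemma has_bochner_integral_tail:
  assumes sq: "integrable M (\<lambda>y. y\<^sup>2)"
  shows "has_bochner_integral lborel tail (\<integral>y. y * to_gauss y \<partial>M)"
proof -
  have P: "pair_sigma_finite M lborel"
    by (rule pair_sigma_finite.intro; unfold_locales)
  \<comment> \<open>Subtracting the indicator of \<open>y < 0\<close> makes the kernel integrable; it does not change
    the integral in \<open>w\<close> because \<^const>\<open>to_gauss\<close> has mean zero.\<close>
  define k :: "real \<Rightarrow> real \<Rightarrow> real" where "k w y = (if y < w then 1 else 0) - (if y < 0 then 1 else 0)" for w y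
  have k_eq: "k w = (\<lambda>y. if 0 \<le> w then indicator {0..<w} y else - indicator {w..<0} y)" for w
    by (auto simp: k_def fun_eq_iff split: split_indicator)
  have k_int: "integrable lborel (k w)" for w
    unfolding k_eq by (cases "0 \<le> w") auto
  have k_integral: "(\<integral>y. k w y \<partial>lborel) = w" for w
    unfolding k_eq by (cases "0 \<le> w") auto
  have k_abs: "(\<integral>y. \<bar>k w y\<bar> \<partial>lborel) = \<bar>w\<bar>" for w
  proof -
    have "(\<integral>y. \<bar>k w y\<bar> \<partial>lborel) = (\<integral>y. (if 0 \<le> w then indicator {0..<w} y else indicator {w..<0} y) \<partial>lborel)"
      unfolding k_eq by (rule Bochner_Integration.integral_cong) auto
    then show ?thesis by (cases "0 \<le> w") auto
  qed
  have k_meas [measurable]: "case_prod k \<in> borel_measurable (M \<Otimes>\<^sub>M lborel)"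
    unfolding k_def[abs_def] by measurable
  have int: "integrable (M \<Otimes>\<^sub>M lborel) (\<lambda>(w, y). to_gauss w * k w y)"
  proof (rule pair_sigma_finite.Fubini_integrable[OF P])
    show "(\<lambda>(w, y). to_gauss w * k w y) \<in> borel_measurable (M \<Otimes>\<^sub>M lborel)"
      by measurable
    have "integrable M (\<lambda>w. norm (w * to_gauss w))"
      using integrable_id_to_gauss[OF sq] by (rule integrable_norm)
    then show "integrable M (\<lambda>x. LINT y|lborel. norm (case (x, y) of (w, y) \<Rightarrow> to_gauss w * k w y))"
      by (simp add: abs_mult k_abs mult.commute)
    show "AE x in M. integrable lborel (\<lambda>y. case (x, y) of (w, y) \<Rightarrow> to_gauss w * k w y)"
      using k_int by simp
  qed
  have tail: "(\<integral>w. to_gauss w * k w y \<partial>M) = tail y" for y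
  proof -
    have "(\<integral>w. to_gauss w * k w y \<partial>M) =
      (\<integral>w. to_gauss w * indicator {y<..} w - to_gauss w * indicator {..<0} y \<partial>M)"
      by (rule Bochner_Integration.integral_cong) (auto simp: k_def algebra_simps)
    also have "\<dots> = tail y - (\<integral>w. to_gauss w * indicator {..<0} y \<partial>M)"
      unfolding tail_def using integrable_to_gauss(1)
      by (intro Bochner_Integration.integral_diff) (auto intro!: integrable_real_mult_indicator)
    finally show ?thesis
      by (simp add: integrable_to_gauss)
  qed
  have "(\<integral>y. (\<integral>w. to_gauss w * k w y \<partial>M) \<partial>lborel) = (\<integral>w. (\<integral>y. to_gauss w * k w y \<partial>lborel) \<partial>M)"
    by (rule pair_sigma_finite.Fubini_integral[OF P]) (use int in simp)
  moreover have "integrable lborel (\<lambda>y. \<integral>w. to_gauss w * k w y \<partial>M)"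
    using pair_sigma_finite.integrable_snd[OF P int] by simp
  ultimately show ?thesis
    by (simp add: tail k_integral has_bochner_integral_iff mult.commute)
qed

end

section \<open>Entropy bound in dimension one\<close>

text \<open>This is \<open>t * ln t\<close> minus its tangent at 1. It is nonnegative, which allows
  domination arguments, and has the same integral as \<open>t * ln t\<close> against a probability
  measure when the density integrates to 1.\<close>

definition ent_fn :: "real \<Rightarrow> real" where
  "ent_fn t = t * ln t - t + 1"

lemma measurable_ent_fn [measurable]: "ent_fn \<in> borel_measurable borel"
  unfolding ent_fn_def[abs_def] by measurable

text \<open>The left-hand side is the tangent at \<open>k\<close> of the convex function
  \<open>ent_fn\<close>; this is the pointwise form of Gibbs' inequality.\<close>

lemma ent_fn_ge:
  assumes "0 < t" "0 < k"
  shows "t * ln k - k + 1 \<le> ent_fn t"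
proof -
  have "t * ln (k / t) \<le> t * (k / t - 1)"
    using assms by (intro mult_left_mono ln_le_minus_one) auto
  then show ?thesis
    using assms by (simp add: ent_fn_def ln_div algebra_simps)
qed

lemma ent_fn_nonneg: "0 \<le> t \<Longrightarrow> 0 \<le> ent_fn t"
  using ent_fn_ge[of t 1] by (cases "t = 0") (auto simp: ent_fn_def)

text \<open>Monotone transport of the law whose density is proportional to \<open>f\<close>, written
  with explicit integrals so that it stays jointly measurable when \<open>f\<close> depends on a
  parameter. If \<open>f\<close> has integral 0, the quotient is 0 and so is the map.\<close>

definition slice_map :: "(real \<Rightarrow> real) \<Rightarrow> real \<Rightarrow> real" where
  "slice_map f y = gauss_quantile ((\<integral>w. f w * indicator {..y} w \<partial>gauss1) / (\<integral>w. f w \<partial>gauss1))"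

text \<open>One section of a joint density relative to \<open>gauss1\<close>, left unnormalised: its
  mass \<open>m\<close> is the value of the marginal density.\<close>

locale gauss_slice =
  fixes f :: "real \<Rightarrow> real" and m :: real
  assumes f_measurable [measurable]: "f \<in> borel_measurable borel"
    and f_nonneg: "\<And>y. 0 \<le> f y"
    and f_int: "integrable gauss1 f"
    and m_def: "m = (\<integral>y. f y \<partial>gauss1)"
    and m_pos: "0 < m"
begin

definition slice :: "real measure" where
  "slice = density gauss1 (\<lambda>y. ennreal (f y / m))"

lemma sets_slice [simp, measurable_cong]: "sets slice = sets borel"
  by (simp add: slice_def)

lemma integrable_slice: "g \<in> borel_measurable borel \<Longrightarrow> integrable slice g \<longleftrightarrow> integrable gauss1 (\<lambda>y. f y * g y :: real)"
  unfolding slice_def using f_nonneg m_pos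
  by (subst integrable_density) (auto simp: divide_inverse mult_ac)

lemma integral_slice: "g \<in> borel_measurable borel \<Longrightarrow> (\<integral>y. g y \<partial>slice) = (\<integral>y. f y * g y \<partial>gauss1) / m" for g :: "real \<Rightarrow> real"
  unfolding slice_def using f_nonneg m_pos
  by (subst integral_density) (auto simp: divide_inverse mult_ac)

lemma nn_integral_slice:
  "g \<in> borel_measurable borel \<Longrightarrow> (\<integral>\<^sup>+y. g y \<partial>slice) = (\<integral>\<^sup>+y. ennreal (f y / m) * g y \<partial>gauss1)"
  unfolding slice_def by (rule nn_integral_density) auto

lemma real_distribution_slice: "real_distribution slice"
proof -
  have "emeasure slice (space slice) = ennreal (\<integral>y. f y / m \<partial>gauss1)"
    using f_nonneg m_pos f_int
    by (simp add: slice_def emeasure_density nn_integral_eq_integral)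
  also have "\<dots> = 1"
    using m_pos by (simp flip: m_def)
  finally show ?thesis
    by (auto simp: real_distribution_def real_distribution_axioms_def slice_def intro!: prob_spaceI)
qed

lemma cdf_slice: "cdf slice y = (\<integral>w. f w * indicator {..y} w \<partial>gauss1) / m"
proof -
  interpret S: real_distribution slice by (rule real_distribution_slice)
  have "cdf slice y = (\<integral>w. indicator {..y} w \<partial>slice)"
    by (simp add: cdf_def)
  also have "\<dots> = (\<integral>w. f w * indicator {..y} w \<partial>gauss1) / m"
    by (rule integral_slice) simp
  finally show ?thesis .
qed

sublocale S: atomless_distribution slice
proof -
  interpret S: real_distribution slice by (rule real_distribution_slice)
  have "measure slice {x} = 0" for x
  proof -
    have "AE y in gauss1. y \<noteq> x"
      unfolding AE_gauss1 by (rule AE_lborel_singleton)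
    then have "AE y in slice. y \<noteq> x"
      unfolding slice_def by (subst AE_density) auto
    then show ?thesis
      by (subst S.prob_eq_0) auto
  qed
  then show "atomless_distribution slice"
    by unfold_locales
qed

lemma slice_map_eq: "slice_map f = S.to_gauss"
  by (simp add: fun_eq_iff slice_map_def S.to_gauss_def cdf_slice flip: m_def)

lemma nn_integral_slice_map:
  assumes [measurable]: "u \<in> borel_measurable borel"
  shows "(\<integral>\<^sup>+y. ennreal (f y) * u (slice_map f y) \<partial>gauss1) = ennreal m * (\<integral>\<^sup>+z. u z \<partial>gauss1)"
proof -
  have "(\<integral>\<^sup>+z. u z \<partial>gauss1) = (\<integral>\<^sup>+y. u (S.to_gauss y) \<partial>slice)"
    by (subst S.distr_to_gauss[symmetric], subst nn_integral_distr) auto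
  also have "\<dots> = (\<integral>\<^sup>+y. ennreal (f y / m) * u (S.to_gauss y) \<partial>gauss1)"
    by (rule nn_integral_slice) measurable
  finally have "ennreal m * (\<integral>\<^sup>+z. u z \<partial>gauss1) = (\<integral>\<^sup>+y. ennreal m * (ennreal (f y / m) * u (S.to_gauss y)) \<partial>gauss1)"
    by (subst nn_integral_cmult) auto
  also have "\<dots> = (\<integral>\<^sup>+y. ennreal (f y) * u (S.to_gauss y) \<partial>gauss1)"
    using m_pos f_nonneg
    by (intro nn_integral_cong) (simp add: mult.assoc[symmetric] ennreal_mult[symmetric])
  finally show ?thesis by (simp add: slice_map_eq)
qed

lemma integral_slice_map_sq:
  "integrable gauss1 (\<lambda>y. f y * (slice_map f y)\<^sup>2)" "(\<integral>y. f y * (slice_map f y)\<^sup>2 \<partial>gauss1) = m"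
  using S.integrable_to_gauss(2,4) m_pos
  by (simp_all add: slice_map_eq integrable_slice integral_slice)

text \<open>Gibbs' inequality against \<open>k y = m / c * \<phi> (S y) / \<phi> y\<close>, with
  \<phi> the Gaussian density and \<open>S\<close> the transport map. The logarithm of
  \<open>k\<close> is quadratic in \<open>y\<close> and \<open>S y\<close>, and its mass is computed
  by the layer-cake formula for the tail. The best \<open>c\<close> is the cross moment of the
  normalised slice; a free \<open>c\<close> keeps the bound linear in that moment.\<close>

lemma entropy_slice_ge:
  assumes sq: "integrable gauss1 (\<lambda>y. f y * y\<^sup>2)"
    and ent: "integrable gauss1 (\<lambda>y. ent_fn (f y))"
    and c: "0 < c"
  shows "ent_fn m + (\<integral>y. f y * y\<^sup>2 \<partial>gauss1) / 2 + m / 2 - m * ln c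
      - (\<integral>y. f y * (y * slice_map f y) \<partial>gauss1) / c \<le> (\<integral>y. ent_fn (f y) \<partial>gauss1)"
proof -
  have sq': "integrable slice (\<lambda>y. y\<^sup>2)"
    using sq by (simp add: integrable_slice)
  note tail = S.has_bochner_integral_tail[OF sq']
  have [measurable]: "S.tail \<in> borel_measurable borel"
    using tail by (auto simp: has_bochner_integral_iff)
  have phi: "0 < std_normal_density y" for y
    by (simp add: normal_density_pos)
  define T where "T y = S.tail y / std_normal_density y" for y
  have tail_int: "integrable gauss1 (\<lambda>y. T y)"
    using tail phi by (simp add: T_def integrable_gauss1_iff less_imp_neq[OF phi, symmetric] has_bochner_integral_iff)
  have tail_eq: "(\<integral>y. T y \<partial>gauss1) = (\<integral>y. f y * (y * slice_map f y) \<partial>gauss1) / m"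
    using tail phi
    by (simp add: T_def integral_gauss1 less_imp_neq[OF phi, symmetric] has_bochner_integral_iff integral_slice slice_map_eq)
  define b where "b = m / c"
  \<comment> \<open>This is the tangent bound \<open>f y * ln k - k + 1\<close> with the logarithm
    expanded and \<open>k\<close> replaced by \<open>b * T y\<close>. The two agree only where
    \<open>f\<close> is positive, up to a null set, but \<open>R\<close> is integrable and its
    integral is known.\<close>
  define R where "R y = f y * ln m + ((f y * y\<^sup>2) / 2 - (f y * (slice_map f y)\<^sup>2) / 2 - f y * ln c)
      - b * T y + 1" for y
  have R_int: "integrable gauss1 R"
    unfolding R_def[abs_def]
    by (intro Bochner_Integration.integrable_add Bochner_Integration.integrable_diff
        integrable_mult_left integrable_mult_right integrable_divide_zero
        f_int sq integral_slice_map_sq tail_int) auto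
  have "AE y in slice. S.tail y = std_normal_density (slice_map f y)"
    using S.AE_tail_eq by (simp add: slice_map_eq)
  then have "AE y in gauss1. 0 < f y / m \<longrightarrow> S.tail y = std_normal_density (slice_map f y)"
    unfolding slice_def by (subst (asm) AE_density) auto
  then have "AE y in gauss1. R y \<le> ent_fn (f y)"
  proof eventually_elim
    case (elim y)
    show ?case
    proof (cases "f y = 0")
      case True
      then show ?thesis
        using m_pos c S.tail_nonneg[of y] phi[of y] by (simp add: R_def T_def b_def ent_fn_def)
    next
      case False
      then have fy: "0 < f y" using f_nonneg[of y] by simp
      define k where "k = m / c * (std_normal_density (slice_map f y) / std_normal_density y)"
      have k: "0 < k" using m_pos c phi by (simp add: k_def)
      have "k = m / c * (exp (- (slice_map f y)\<^sup>2 / 2) / exp (- y\<^sup>2 / 2))"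
        by (simp add: k_def std_normal_density_def)
      also have "\<dots> = m / c * exp (y\<^sup>2 / 2 - (slice_map f y)\<^sup>2 / 2)"
        by (simp add: exp_diff[symmetric] exp_minus divide_simps flip: exp_add)
      finally have "ln k = ln m - ln c + (y\<^sup>2 / 2 - (slice_map f y)\<^sup>2 / 2)"
        using m_pos c by (simp add: ln_mult ln_div)
      moreover have "R y = f y * (ln m - ln c + (y\<^sup>2 / 2 - (slice_map f y)\<^sup>2 / 2)) - k + 1"
        using elim fy m_pos by (simp add: R_def T_def b_def k_def algebra_simps)
      ultimately have "R y = f y * ln k - k + 1"
        by simp
      then show ?thesis
        using ent_fn_ge[OF fy k] by simp
    qed
  qed
  then have "(\<integral>y. R y \<partial>gauss1) \<le> (\<integral>y. ent_fn (f y) \<partial>gauss1)"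
    by (rule integral_mono_AE[OF R_int ent])
  moreover have "(\<integral>y. R y \<partial>gauss1) = m * ln m + ((\<integral>y. f y * y\<^sup>2 \<partial>gauss1) / 2 - m / 2 - m * ln c)
      - b * ((\<integral>y. f y * (y * slice_map f y) \<partial>gauss1) / m) + 1"
    unfolding R_def
    by (simp add: f_int sq integral_slice_map_sq tail_int tail_eq gauss1.prob_space[simplified]
        flip: m_def)
  ultimately show ?thesis
    using m_pos c by (simp add: ent_fn_def b_def field_simps)
qed

end

section \<open>Adding one coordinate\<close>

text \<open>Integrals depending on a parameter are measurable in it, so the transports of the
  individual sections form one measurable map.\<close>

lemma measurable_slice_map_pair [measurable]:
  assumes [measurable]: "case_prod f \<in> borel_measurable (A \<Otimes>\<^sub>M borel)"
  shows "(\<lambda>(x, y). slice_map (f x) y) \<in> borel_measurable (A \<Otimes>\<^sub>M borel)"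
proof -
  have [measurable]: "(\<lambda>(p, w). f (fst p) w) \<in> borel_measurable ((A \<Otimes>\<^sub>M borel) \<Otimes>\<^sub>M gauss1)"
    by measurable
  have [measurable]: "(\<lambda>(p, w). f (fst p) w * indicator {..snd p} w :: real)
      \<in> borel_measurable ((A \<Otimes>\<^sub>M borel) \<Otimes>\<^sub>M gauss1)"
  proof -
    \<comment> \<open>The indicator of a moving half-line is recast as the comparison
      \<open>w \<le> snd p\<close>, whose joint measurability is immediate.\<close>
    have "(\<lambda>(p, w). f (fst p) w * (if w \<le> snd p then 1 else 0) :: real)
      \<in> borel_measurable ((A \<Otimes>\<^sub>M borel) \<Otimes>\<^sub>M gauss1)"
      by measurable
    then show ?thesis
      by (rule measurable_cong[THEN iffD1, rotated]) (auto split: split_indicator)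
  qed
  have "(\<lambda>p. gauss_quantile ((\<integral>w. f (fst p) w * indicator {..snd p} w \<partial>gauss1) / (\<integral>w. f (fst p) w \<partial>gauss1)))
    \<in> borel_measurable (A \<Otimes>\<^sub>M borel)"
    by measurable
  then show ?thesis
    by (simp add: slice_map_def case_prod_beta')
qed

text \<open>The measure \<open>A\<close> carries the earlier coordinates, and \<open>f\<close> is a
  joint density of these and one new coordinate relative to the product with
  \<open>gauss1\<close>.\<close>

locale gauss_extension = A: prob_space A for A :: "'a measure" +
  fixes f :: "'a \<Rightarrow> real \<Rightarrow> real"
  assumes f_measurable [measurable]: "case_prod f \<in> borel_measurable (A \<Otimes>\<^sub>M borel)"
    and f_nonneg: "\<And>x y. 0 \<le> f x y"
    and f_int: "integrable (A \<Otimes>\<^sub>M gauss1) (\<lambda>(x, y). f x y)"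
begin

definition marginal :: "'a \<Rightarrow> real" where
  "marginal x = (\<integral>y. f x y \<partial>gauss1)"

lemma pair: "pair_sigma_finite A gauss1"
  by (rule pair_sigma_finite.intro; unfold_locales)

lemma measurable_marginal [measurable]: "marginal \<in> borel_measurable A"
  unfolding marginal_def[abs_def] by measurable

lemma marginal_nonneg: "0 \<le> marginal x"
  unfolding marginal_def by (intro integral_nonneg_AE AE_I2 f_nonneg)

lemma integrable_marginal: "integrable A marginal"
  using pair_sigma_finite.integrable_fst'[OF pair f_int] by (simp add: marginal_def[abs_def])

lemma integral_marginal: "(\<integral>x. marginal x \<partial>A) = (\<integral>(x, y). f x y \<partial>(A \<Otimes>\<^sub>M gauss1))"
  using pair_sigma_finite.integral_fst'[OF pair f_int] by (simp add: marginal_def[abs_def])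

text \<open>A section of zero mass cannot be normalised, but then it vanishes almost everywhere and
  its contributions are trivial.\<close>

lemma slice_cases:
  assumes "x \<in> space A" "integrable gauss1 (f x)"
  obtains "marginal x = 0" "AE y in gauss1. f x y = 0" | "gauss_slice (f x) (marginal x)"
proof (cases "marginal x = 0")
  case True
  moreover have "AE y in gauss1. f x y = 0"
    using True assms f_nonneg by (subst integral_nonneg_eq_0_iff_AE[symmetric]) (auto simp: marginal_def)
  ultimately show ?thesis by (rule that(1))
next
  case False
  have "f x \<in> borel_measurable borel"
    using assms(1) by measurable
  moreover have "0 < marginal x"
    using False marginal_nonneg[of x] by simp
  ultimately have "gauss_slice (f x) (marginal x)"
    using assms f_nonneg by unfold_locales (simp_all add: marginal_def)
  then show ?thesis by (rule that(2))
qed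

lemma AE_integrable_slice: "AE x in A. integrable gauss1 (f x)"
  using pair_sigma_finite.AE_integrable_fst'[OF pair f_int] by simp

text \<open>Given \<open>x\<close>, the slice map sends the conditional law of the new coordinate to
  the Gaussian, so the new coordinate becomes Gaussian and independent of \<open>x\<close>, which
  keeps its marginal density.\<close>

lemma nn_integral_transport:
  assumes [measurable]: "case_prod u \<in> borel_measurable (A \<Otimes>\<^sub>M borel)"
  shows "(\<integral>\<^sup>+(x, y). ennreal (f x y) * u x (slice_map (f x) y) \<partial>(A \<Otimes>\<^sub>M gauss1))
    = (\<integral>\<^sup>+x. ennreal (marginal x) * (\<integral>\<^sup>+z. u x z \<partial>gauss1) \<partial>A)"
proof -
  have [measurable]: "(\<lambda>p. slice_map (f (fst p)) (snd p)) \<in> borel_measurable (A \<Otimes>\<^sub>M gauss1)"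
    using measurable_slice_map_pair[OF f_measurable] by (simp add: case_prod_beta' cong: measurable_cong_sets)
  have "(\<lambda>(x, y). ennreal (f x y) * u x (slice_map (f x) y)) \<in> borel_measurable (A \<Otimes>\<^sub>M gauss1)"
    by measurable
  then have "(\<integral>\<^sup>+(x, y). ennreal (f x y) * u x (slice_map (f x) y) \<partial>(A \<Otimes>\<^sub>M gauss1))
    = (\<integral>\<^sup>+x. (\<integral>\<^sup>+y. ennreal (f x y) * u x (slice_map (f x) y) \<partial>gauss1) \<partial>A)"
    by (subst gauss1.nn_integral_fst[symmetric]) auto
  also have "\<dots> = (\<integral>\<^sup>+x. ennreal (marginal x) * (\<integral>\<^sup>+z. u x z \<partial>gauss1) \<partial>A)"
  proof (rule nn_integral_cong_AE)
    show "AE x in A. (\<integral>\<^sup>+y. ennreal (f x y) * u x (slice_map (f x) y) \<partial>gauss1)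
      = ennreal (marginal x) * (\<integral>\<^sup>+z. u x z \<partial>gauss1)"
      using AE_integrable_slice AE_space
    proof eventually_elim
      case (elim x)
      have [measurable]: "u x \<in> borel_measurable borel"
        using elim(2) by measurable
      from elim(2,1) show ?case
      proof (cases rule: slice_cases)
        case 1
        then have "(\<integral>\<^sup>+y. ennreal (f x y) * u x (slice_map (f x) y) \<partial>gauss1) = (\<integral>\<^sup>+y. 0 \<partial>gauss1)"
          by (intro nn_integral_cong_AE) auto
        then show ?thesis using 1 by simp
      next
        case 2
        then interpret gauss_slice "f x" "marginal x" .
        show ?thesis by (rule nn_integral_slice_map) measurable
      qed
    qed
  qed
  finally show ?thesis .
qed

text \<open>The one-dimensional bound integrated over \<open>x\<close>. At \<open>c = 1\<close> it
  also places \<open>ent_fn (marginal x)\<close> between 0 and an integrable function, which gives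
  the first conclusion.\<close>

lemma entropy_chain:
  assumes sq: "integrable (A \<Otimes>\<^sub>M gauss1) (\<lambda>(x, y). f x y * y\<^sup>2)"
    and ent: "integrable (A \<Otimes>\<^sub>M gauss1) (\<lambda>(x, y). ent_fn (f x y))"
    and cross: "integrable (A \<Otimes>\<^sub>M gauss1) (\<lambda>(x, y). f x y * (y * slice_map (f x) y))"
  shows "integrable A (\<lambda>x. ent_fn (marginal x))" (is ?int)
    and "0 < c \<Longrightarrow> (\<integral>x. ent_fn (marginal x) \<partial>A) + (\<integral>(x, y). f x y * y\<^sup>2 \<partial>(A \<Otimes>\<^sub>M gauss1)) / 2
      + (\<integral>x. marginal x \<partial>A) / 2 - (\<integral>x. marginal x \<partial>A) * ln c
      - (\<integral>(x, y). f x y * (y * slice_map (f x) y) \<partial>(A \<Otimes>\<^sub>M gauss1)) / c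
      \<le> (\<integral>(x, y). ent_fn (f x y) \<partial>(A \<Otimes>\<^sub>M gauss1))" (is "_ \<Longrightarrow> ?ineq c")
proof -
  define Q where "Q x = (\<integral>y. f x y * y\<^sup>2 \<partial>gauss1)" for x
  define H where "H x = (\<integral>y. ent_fn (f x y) \<partial>gauss1)" for x
  define X where "X x = (\<integral>y. f x y * (y * slice_map (f x) y) \<partial>gauss1)" for x
  have Q: "integrable A Q" "(\<integral>x. Q x \<partial>A) = (\<integral>(x, y). f x y * y\<^sup>2 \<partial>(A \<Otimes>\<^sub>M gauss1))"
    using pair_sigma_finite.integrable_fst'[OF pair sq] pair_sigma_finite.integral_fst'[OF pair sq]
    by (simp_all add: Q_def[abs_def])
  have H: "integrable A H" "(\<integral>x. H x \<partial>A) = (\<integral>(x, y). ent_fn (f x y) \<partial>(A \<Otimes>\<^sub>M gauss1))"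
    using pair_sigma_finite.integrable_fst'[OF pair ent] pair_sigma_finite.integral_fst'[OF pair ent]
    by (simp_all add: H_def[abs_def])
  have X: "integrable A X" "(\<integral>x. X x \<partial>A) = (\<integral>(x, y). f x y * (y * slice_map (f x) y) \<partial>(A \<Otimes>\<^sub>M gauss1))"
    using pair_sigma_finite.integrable_fst'[OF pair cross] pair_sigma_finite.integral_fst'[OF pair cross]
    by (simp_all add: X_def[abs_def])
  have le: "AE x in A. ent_fn (marginal x) \<le> H x - (Q x / 2 + marginal x / 2 - marginal x * ln c - X x / c)"
    if c: "0 < c" for c
    using AE_integrable_slice AE_space pair_sigma_finite.AE_integrable_fst'[OF pair sq]
      pair_sigma_finite.AE_integrable_fst'[OF pair ent]
  proof eventually_elim
    case (elim x)
    from elim(2,1) show ?case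
    proof (cases rule: slice_cases)
      \<comment> \<open>For a section of zero mass both sides equal \<open>ent_fn 0 = 1\<close>, and
        the moment terms vanish.\<close>
      case 1
      have [measurable]: "f x \<in> borel_measurable borel"
        using elim(2) by measurable
      have "H x = (\<integral>y. 1 \<partial>gauss1)"
        unfolding H_def using 1(2) by (intro integral_cong_AE) (auto simp: ent_fn_def)
      moreover have "Q x = 0" "X x = 0"
        unfolding Q_def X_def using 1(2) by (auto intro!: integral_eq_zero_AE)
      ultimately show ?thesis
        using 1(1) gauss1.prob_space by (simp add: ent_fn_def)
    next
      case 2
      then interpret gauss_slice "f x" "marginal x" .
      show ?thesis
        using entropy_slice_ge[OF _ _ c] elim(3,4) by (simp add: H_def Q_def X_def)
    qed
  qed
  have bound: "integrable A (\<lambda>x. H x - (Q x / 2 + marginal x / 2 - marginal x * ln c - X x / c))" for c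
    using Q H X integrable_marginal by auto
  show int: ?int
  proof (rule Bochner_Integration.integrable_bound)
    show "integrable A (\<lambda>x. H x - (Q x / 2 + marginal x / 2 - marginal x * ln 1 - X x / 1))"
      by (rule bound)
    show "AE x in A. norm (ent_fn (marginal x))
        \<le> norm (H x - (Q x / 2 + marginal x / 2 - marginal x * ln 1 - X x / 1))"
      using le[OF zero_less_one]
    proof eventually_elim
      case (elim x)
      then show ?case
        using ent_fn_nonneg[OF marginal_nonneg, of x] unfolding real_norm_def by linarith
    qed
  qed measurable
  show "?ineq c" if "0 < c"
  proof -
    have "(\<integral>x. ent_fn (marginal x) \<partial>A)
      \<le> (\<integral>x. H x - (Q x / 2 + marginal x / 2 - marginal x * ln c - X x / c) \<partial>A)"
      by (rule integral_mono_AE[OF int bound le[OF that]])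
    also have "\<dots> = (\<integral>x. H x \<partial>A) - ((\<integral>x. Q x \<partial>A) / 2 + (\<integral>x. marginal x \<partial>A) / 2
        - (\<integral>x. marginal x \<partial>A) * ln c - (\<integral>x. X x \<partial>A) / c)"
      using Q H X integrable_marginal by simp
    finally show ?thesis
      unfolding Q H X by linarith
  qed
qed

end

text \<open>Domination by \<open>2 * \<bar>a x * b x\<bar> \<le> (a x)\<^sup>2 + (b
  x)\<^sup>2\<close>.\<close>

lemma integrable_weighted_product:
  fixes f a b :: "'a \<Rightarrow> real"
  assumes [measurable]: "f \<in> borel_measurable M" "a \<in> borel_measurable M" "b \<in> borel_measurable M"
    and "\<And>x. 0 \<le> f x"
    and a: "integrable M (\<lambda>x. f x * (a x)\<^sup>2)" and b: "integrable M (\<lambda>x. f x * (b x)\<^sup>2)"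
  shows "integrable M (\<lambda>x. f x * (a x * b x))"
proof (rule Bochner_Integration.integrable_bound[OF Bochner_Integration.integrable_add[OF a b]])
  show "AE x in M. norm (f x * (a x * b x)) \<le> norm (f x * (a x)\<^sup>2 + f x * (b x)\<^sup>2)"
  proof (rule AE_I2)
    fix x
    have "2 * \<bar>a x * b x\<bar> \<le> (a x)\<^sup>2 + (b x)\<^sup>2"
      using sum_squares_bound[of "\<bar>a x\<bar>" "\<bar>b x\<bar>"] by (simp add: abs_mult mult.assoc)
    then have "\<bar>a x * b x\<bar> \<le> (a x)\<^sup>2 + (b x)\<^sup>2"
      using abs_ge_zero[of "a x * b x"] by linarith
    then have "f x * \<bar>a x * b x\<bar> \<le> f x * ((a x)\<^sup>2 + (b x)\<^sup>2)"
      using assms(4) by (rule mult_left_mono)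
    then show "norm (f x * (a x * b x)) \<le> norm (f x * (a x)\<^sup>2 + f x * (b x)\<^sup>2)"
      using assms(4)[of x] by (simp add: abs_mult distrib_left)
  qed
qed measurable

section \<open>Triangular transport of a density on a product space\<close>

abbreviation gauss_prod :: "'i set \<Rightarrow> ('i \<Rightarrow> real) measure" where
  "gauss_prod I \<equiv> Pi\<^sub>M I (\<lambda>_. gauss1)"

lemma product_sigma_finite_gauss: "product_sigma_finite (\<lambda>_. gauss1)"
  by (rule product_sigma_finite.intro) (rule gauss1.sigma_finite_measure_axioms)

lemma prob_space_gauss_prod: "prob_space (gauss_prod I)"
  by (rule prob_space_PiM) (rule prob_space_gauss1)

lemma measurable_gauss_prod_update [measurable]:
  "(\<lambda>p. (fst p)(j := snd p)) \<in> measurable (gauss_prod I \<Otimes>\<^sub>M gauss1) (gauss_prod (insert j I))"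
  using measurable_add_dim[of j I "\<lambda>_. gauss1"] by (simp add: case_prod_beta')

text \<open>Phrased as a push-forward, so that integrability and both kinds of integrals transfer
  from this one identity.\<close>

lemma distr_gauss_prod_insert:
  assumes "finite I" "j \<notin> I"
  shows "distr (gauss_prod I \<Otimes>\<^sub>M gauss1) (gauss_prod (insert j I)) (\<lambda>p. (fst p)(j := snd p)) = gauss_prod (insert j I)"
    (is "?D = _")
proof (rule measure_eqI)
  fix X assume "X \<in> sets ?D"
  then have X [measurable]: "X \<in> sets (gauss_prod (insert j I))" by simp
  have "emeasure (gauss_prod (insert j I)) X = (\<integral>\<^sup>+x. indicator X x \<partial>gauss_prod (insert j I))"
    by simp
  also have "\<dots> = (\<integral>\<^sup>+x. \<integral>\<^sup>+y. indicator X (x(j := y)) \<partial>gauss1 \<partial>gauss_prod I)"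
    by (rule product_sigma_finite.product_nn_integral_insert[OF product_sigma_finite_gauss assms]) simp
  also have "\<dots> = (\<integral>\<^sup>+p. indicator X ((fst p)(j := snd p)) \<partial>(gauss_prod I \<Otimes>\<^sub>M gauss1))"
    by (subst gauss1.nn_integral_fst[symmetric]) auto
  also have "\<dots> = (\<integral>\<^sup>+x. indicator X x \<partial>?D)"
    by (subst nn_integral_distr) auto
  also have "\<dots> = emeasure ?D X"
    by simp
  finally show "emeasure ?D X = emeasure (gauss_prod (insert j I)) X" by simp
qed simp

lemma integrable_gauss_prod_insert:
  fixes g :: "('i \<Rightarrow> real) \<Rightarrow> real"
  assumes "finite I" "j \<notin> I" and [measurable]: "g \<in> borel_measurable (gauss_prod (insert j I))"
  shows "integrable (gauss_prod (insert j I)) g \<longleftrightarrow>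
    integrable (gauss_prod I \<Otimes>\<^sub>M gauss1) (\<lambda>(x, y). g (x(j := y)))"
  by (subst distr_gauss_prod_insert[OF assms(1,2), symmetric], subst integrable_distr_eq)
    (auto simp: case_prod_beta')

lemma integral_gauss_prod_insert:
  fixes g :: "('i \<Rightarrow> real) \<Rightarrow> real"
  assumes "finite I" "j \<notin> I" and [measurable]: "g \<in> borel_measurable (gauss_prod (insert j I))"
  shows "(\<integral>w. g w \<partial>gauss_prod (insert j I)) = (\<integral>(x, y). g (x(j := y)) \<partial>(gauss_prod I \<Otimes>\<^sub>M gauss1))"
  by (subst distr_gauss_prod_insert[OF assms(1,2), symmetric], subst integral_distr)
    (auto simp: case_prod_beta')

lemma nn_integral_gauss_prod_insert:
  assumes "finite I" "j \<notin> I" and [measurable]: "g \<in> borel_measurable (gauss_prod (insert j I))"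
  shows "(\<integral>\<^sup>+w. g w \<partial>gauss_prod (insert j I)) = (\<integral>\<^sup>+(x, y). g (x(j := y)) \<partial>(gauss_prod I \<Otimes>\<^sub>M gauss1))"
  by (subst distr_gauss_prod_insert[OF assms(1,2), symmetric], subst nn_integral_distr)
    (auto simp: case_prod_beta')

lemma gauss_prod_component_sq:
  assumes "finite I" "i \<in> I"
  shows "(\<integral>\<^sup>+x. ennreal ((x i)\<^sup>2) \<partial>gauss_prod I) = 1"
proof -
  have "(\<integral>\<^sup>+x. ennreal ((x i)\<^sup>2) \<partial>gauss_prod I) = (\<integral>\<^sup>+y. ennreal (y\<^sup>2) \<partial>distr (gauss_prod I) gauss1 (\<lambda>x. x i))"
    using assms(2) by (subst nn_integral_distr) auto
  also have "distr (gauss_prod I) gauss1 (\<lambda>x. x i) = gauss1"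
    using assms prob_space_gauss1 by (intro distr_PiM_component) auto
  also have "(\<integral>\<^sup>+y. ennreal (y\<^sup>2) \<partial>gauss1) = 1"
    using gauss1_second_moment by (simp add: nn_integral_eq_integral)
  finally show ?thesis .
qed

text \<open>The transport identity is applied to the test function \<open>(x i)\<^sup>2\<close>,
  whose Gaussian integral is 1.\<close>

lemma transported_sq:
  assumes "finite I" "i \<in> I" and [measurable]: "f \<in> borel_measurable (gauss_prod I)"
    and [measurable]: "S \<in> measurable (gauss_prod I) (gauss_prod I)"
    and "\<And>x. 0 \<le> f x"
    and transport: "\<And>u. u \<in> borel_measurable (gauss_prod I) \<Longrightarrow>
      (\<integral>\<^sup>+x. ennreal (f x) * u (S x) \<partial>gauss_prod I) = (\<integral>\<^sup>+x. u x \<partial>gauss_prod I)"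
  shows "integrable (gauss_prod I) (\<lambda>x. f x * (S x i)\<^sup>2)" "(\<integral>x. f x * (S x i)\<^sup>2 \<partial>gauss_prod I) = 1"
proof -
  have [measurable]: "(\<lambda>x. x i) \<in> borel_measurable (gauss_prod I)"
    using assms(2) by measurable
  have "(\<integral>\<^sup>+x. ennreal (f x * (S x i)\<^sup>2) \<partial>gauss_prod I) = 1"
    using transport[of "\<lambda>x. ennreal ((x i)\<^sup>2)"] gauss_prod_component_sq[OF assms(1,2)] assms(5)
    by (simp add: ennreal_mult)
  moreover have "(\<lambda>x. f x * (S x i)\<^sup>2) \<in> borel_measurable (gauss_prod I)"
    by measurable
  ultimately have "has_bochner_integral (gauss_prod I) (\<lambda>x. f x * (S x i)\<^sup>2) 1"
    using assms(5) by (intro has_bochner_integral_nn_integral) auto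
  then show "integrable (gauss_prod I) (\<lambda>x. f x * (S x i)\<^sup>2)" "(\<integral>x. f x * (S x i)\<^sup>2 \<partial>gauss_prod I) = 1"
    by (auto simp: has_bochner_integral_iff)
qed

text \<open>Induction on the coordinates: the marginal density, with coordinate \<open>j\<close>
  integrated out, has a map by the induction hypothesis, and the slice map supplies component
  \<open>j\<close>. Transport and entropy are proved together because the cross moments in the
  entropy bound belong to the very map that is constructed.\<close>

theorem triangular_transport:
  fixes f :: "('i \<Rightarrow> real) \<Rightarrow> real"
  assumes "finite I"
    and "f \<in> borel_measurable (gauss_prod I)"
    and "\<And>x. 0 \<le> f x"
    and "integrable (gauss_prod I) f" "(\<integral>x. f x \<partial>gauss_prod I) = 1"
    and "integrable (gauss_prod I) (\<lambda>x. ent_fn (f x))"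
    and "\<And>i. i \<in> I \<Longrightarrow> integrable (gauss_prod I) (\<lambda>x. f x * (x i)\<^sup>2)"
  shows "\<exists>S \<in> measurable (gauss_prod I) (gauss_prod I).
    (\<forall>u \<in> borel_measurable (gauss_prod I).
      (\<integral>\<^sup>+x. ennreal (f x) * u (S x) \<partial>gauss_prod I) = (\<integral>\<^sup>+x. u x \<partial>gauss_prod I)) \<and>
    (\<forall>c. (\<forall>i\<in>I. 0 < c i) \<longrightarrow>
      (\<Sum>i\<in>I. (\<integral>x. f x * (x i)\<^sup>2 \<partial>gauss_prod I) / 2 + 1 / 2 - ln (c i)
        - (\<integral>x. f x * (x i * S x i) \<partial>gauss_prod I) / c i) \<le> (\<integral>x. ent_fn (f x) \<partial>gauss_prod I))"
  using assms
proof (induction I arbitrary: f rule: finite_induct)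
  case empty
  \<comment> \<open>The empty product is a point mass, so the density is 1 there and the entropy is
    \<open>ent_fn 1 = 0\<close>.\<close>
  have "f (\<lambda>_. undefined) = 1"
    using empty.prems(4) by (simp add: PiM_empty lebesgue_integral_count_space_finite)
  then show ?case
    using empty.prems(2) by (intro bexI[of _ id]) (auto simp: PiM_empty nn_integral_count_space_finite lebesgue_integral_count_space_finite ent_fn_def)
next
  case (insert j I)
  let ?N = "gauss_prod I" and ?N' = "gauss_prod (insert j I)"
  note [measurable] = insert.prems(1)
  note nonneg = insert.prems(2)
  note intb = integrable_gauss_prod_insert[OF insert.hyps] integral_gauss_prod_insert[OF insert.hyps]
  interpret N: prob_space ?N by (rule prob_space_gauss_prod)
  define F where "F x y = f (x(j := y))" for x y
  have F_meas [measurable]: "case_prod F \<in> borel_measurable (?N \<Otimes>\<^sub>M gauss1)"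
    unfolding F_def case_prod_beta' by measurable
  then have F_meas' [measurable]: "case_prod F \<in> borel_measurable (?N \<Otimes>\<^sub>M borel)"
    by (simp cong: measurable_cong_sets)
  have comp [measurable]: "i \<in> insert j I \<Longrightarrow> (\<lambda>x. x i) \<in> borel_measurable ?N'" for i
    by measurable
  have F_int: "integrable (?N \<Otimes>\<^sub>M gauss1) (\<lambda>(x, y). F x y)"
    using insert.prems(3) by (simp add: intb F_def)
  interpret E: gauss_extension ?N F
    by unfold_locales (use nonneg F_meas' F_int in \<open>simp_all add: F_def\<close>)
  define s where "s x y = slice_map (F x) y" for x y
  have s_meas [measurable]: "case_prod s \<in> borel_measurable (?N \<Otimes>\<^sub>M gauss1)"
    using measurable_slice_map_pair[OF F_meas'] by (simp add: s_def[abs_def] cong: measurable_cong_sets)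
  have F_sq: "integrable (?N \<Otimes>\<^sub>M gauss1) (\<lambda>(x, y). F x y * y\<^sup>2)"
    using insert.prems(6)[of j] by (simp add: intb F_def)
  have F_comp: "integrable (?N \<Otimes>\<^sub>M gauss1) (\<lambda>(x, y). F x y * (x i)\<^sup>2)" if "i \<in> I" for i
  proof -
    have "i \<noteq> j" using that insert.hyps by auto
    then show ?thesis
      using that insert.prems(6)[of i] by (simp add: intb F_def)
  qed
  have F_ent: "integrable (?N \<Otimes>\<^sub>M gauss1) (\<lambda>(x, y). ent_fn (F x y))"
    using insert.prems(5) by (simp add: intb F_def)
  have marginal_1: "(\<integral>x. E.marginal x \<partial>?N) = 1"
    using insert.prems(4) by (simp add: E.integral_marginal intb F_def)
  have transport_s: "(\<integral>\<^sup>+(x, y). ennreal (F x y) * u x (s x y) \<partial>(?N \<Otimes>\<^sub>M gauss1))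
      = (\<integral>\<^sup>+x. ennreal (E.marginal x) * (\<integral>\<^sup>+z. u x z \<partial>gauss1) \<partial>?N)"
    if "case_prod u \<in> borel_measurable (?N \<Otimes>\<^sub>M gauss1)" for u
    unfolding s_def using that by (intro E.nn_integral_transport) (simp cong: measurable_cong_sets)
  have F_s_sq: "integrable (?N \<Otimes>\<^sub>M gauss1) (\<lambda>(x, y). F x y * (s x y)\<^sup>2)"
  proof (rule integrableI_nonneg)
    have "(\<integral>\<^sup>+p. ennreal (case p of (x, y) \<Rightarrow> F x y * (s x y)\<^sup>2) \<partial>(?N \<Otimes>\<^sub>M gauss1))
      = (\<integral>\<^sup>+(x, y). ennreal (F x y) * ennreal ((s x y)\<^sup>2) \<partial>(?N \<Otimes>\<^sub>M gauss1))"
      using nonneg by (intro nn_integral_cong) (auto simp: F_def ennreal_mult)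
    also have "\<dots> = (\<integral>\<^sup>+x. ennreal (E.marginal x) * (\<integral>\<^sup>+z. ennreal (z\<^sup>2) \<partial>gauss1) \<partial>?N)"
      by (rule transport_s) measurable
    also have "\<dots> = (\<integral>\<^sup>+x. ennreal (E.marginal x) \<partial>?N)"
      using gauss1_second_moment by (simp add: nn_integral_eq_integral)
    also have "\<dots> < \<infinity>"
      using E.integrable_marginal E.marginal_nonneg by (simp add: nn_integral_eq_integral)
    finally show "(\<integral>\<^sup>+p. ennreal (case p of (x, y) \<Rightarrow> F x y * (s x y)\<^sup>2) \<partial>(?N \<Otimes>\<^sub>M gauss1)) < \<infinity>" .
  qed (use nonneg in \<open>auto simp: F_def\<close>)
  have F_cross: "integrable (?N \<Otimes>\<^sub>M gauss1) (\<lambda>(x, y). F x y * (y * s x y))"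
    using integrable_weighted_product[of "case_prod F" "?N \<Otimes>\<^sub>M gauss1" snd "case_prod s"] F_sq F_s_sq nonneg
    by (simp add: case_prod_beta' F_def)
  note chain = E.entropy_chain[OF F_sq F_ent F_cross[unfolded s_def], folded s_def]
  have comp_sq: "integrable ?N (\<lambda>x. E.marginal x * (x i)\<^sup>2)"
    "(\<integral>x. E.marginal x * (x i)\<^sup>2 \<partial>?N) = (\<integral>w. f w * (w i)\<^sup>2 \<partial>?N')" if "i \<in> I" for i
  proof -
    have ij: "i \<noteq> j" using that insert.hyps by auto
    show "integrable ?N (\<lambda>x. E.marginal x * (x i)\<^sup>2)"
      using pair_sigma_finite.integrable_fst'[OF E.pair F_comp[OF that]] by (simp add: E.marginal_def)
    have "(\<integral>w. f w * (w i)\<^sup>2 \<partial>?N') = (\<integral>(x, y). F x y * (x i)\<^sup>2 \<partial>(?N \<Otimes>\<^sub>M gauss1))"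
      using ij that by (simp add: intb F_def)
    then show "(\<integral>x. E.marginal x * (x i)\<^sup>2 \<partial>?N) = (\<integral>w. f w * (w i)\<^sup>2 \<partial>?N')"
      using pair_sigma_finite.integral_fst'[OF E.pair F_comp[OF that]] by (simp add: E.marginal_def)
  qed
  obtain S0 where S0 [measurable]: "S0 \<in> measurable ?N ?N"
    and transport0: "\<And>u. u \<in> borel_measurable ?N \<Longrightarrow>
      (\<integral>\<^sup>+x. ennreal (E.marginal x) * u (S0 x) \<partial>?N) = (\<integral>\<^sup>+x. u x \<partial>?N)"
    and entropy0: "\<And>c. (\<forall>i\<in>I. 0 < c i) \<Longrightarrow>
      (\<Sum>i\<in>I. (\<integral>x. E.marginal x * (x i)\<^sup>2 \<partial>?N) / 2 + 1 / 2 - ln (c i)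
        - (\<integral>x. E.marginal x * (x i * S0 x i) \<partial>?N) / c i) \<le> (\<integral>x. ent_fn (E.marginal x) \<partial>?N)"
    using insert.IH[OF E.measurable_marginal E.marginal_nonneg E.integrable_marginal marginal_1 chain(1) comp_sq(1)]
    by blast
  \<comment> \<open>Triangular form: the components in \<open>I\<close> depend on those coordinates
    alone, while component \<open>j\<close> is the conditional transport given them.\<close>
  define S where "S w = (S0 (restrict w I))(j := s (restrict w I) (w j))" for w
  have restr [measurable]: "(\<lambda>w. restrict w I) \<in> measurable ?N' ?N"
    by (rule measurable_restrict_subset) auto
  have S_meas [measurable]: "S \<in> measurable ?N' ?N'"
  proof -
    have "(\<lambda>w. s (restrict w I) (w j)) \<in> borel_measurable ?N'"
      using measurable_compose[OF measurable_Pair[OF restr measurable_component_singleton] s_meas, of j]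
      by simp
    then have "(\<lambda>w. (S0 (restrict w I))(j := s (restrict w I) (w j))) \<in> measurable ?N' ?N'"
      by (intro measurable_fun_upd[where J = I]) (auto cong: measurable_cong_sets)
    then show ?thesis by (simp add: S_def[abs_def])
  qed
  have S_upd: "S (x(j := y)) = (S0 x)(j := s x y)" if "x \<in> space ?N" for x y
  proof -
    have "restrict (x(j := y)) I = x"
      using that insert.hyps by (auto simp: space_PiM fun_eq_iff PiE_def extensional_def)
    then show ?thesis by (simp add: S_def)
  qed
  have transport: "(\<integral>\<^sup>+w. ennreal (f w) * u (S w) \<partial>?N') = (\<integral>\<^sup>+w. u w \<partial>?N')"
    if [measurable]: "u \<in> borel_measurable ?N'" for u
  proof -
    have upd [measurable]: "(\<lambda>p. (S0 (fst p))(j := snd p)) \<in> measurable (?N \<Otimes>\<^sub>M gauss1) ?N'"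
      by (intro measurable_fun_upd[where J = I]) auto
    have "(\<integral>\<^sup>+w. ennreal (f w) * u (S w) \<partial>?N')
      = (\<integral>\<^sup>+(x, y). ennreal (f (x(j := y))) * u (S (x(j := y))) \<partial>(?N \<Otimes>\<^sub>M gauss1))"
      by (rule nn_integral_gauss_prod_insert[OF insert.hyps]) measurable
    also have "\<dots> = (\<integral>\<^sup>+(x, y). ennreal (F x y) * u ((S0 x)(j := s x y)) \<partial>(?N \<Otimes>\<^sub>M gauss1))"
      by (intro nn_integral_cong) (auto simp: F_def space_pair_measure S_upd)
    \<comment> \<open>First \<open>s\<close> makes coordinate \<open>j\<close> an independent
      Gaussian; then \<open>S0\<close> carries the marginal to the Gaussian product.\<close>
    also have "\<dots> = (\<integral>\<^sup>+x. ennreal (E.marginal x) * (\<integral>\<^sup>+z. u ((S0 x)(j := z)) \<partial>gauss1) \<partial>?N)"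
      by (rule transport_s) (simp add: case_prod_beta')
    also have "\<dots> = (\<integral>\<^sup>+x. (\<integral>\<^sup>+z. u (x(j := z)) \<partial>gauss1) \<partial>?N)"
    proof (rule transport0)
      have "(\<lambda>(x, z). u (x(j := z))) \<in> borel_measurable (?N \<Otimes>\<^sub>M gauss1)"
        unfolding case_prod_beta' by measurable
      then show "(\<lambda>x. \<integral>\<^sup>+z. u (x(j := z)) \<partial>gauss1) \<in> borel_measurable ?N"
        by measurable
    qed
    also have "\<dots> = (\<integral>\<^sup>+w. u w \<partial>?N')"
      by (rule product_sigma_finite.product_nn_integral_insert[OF product_sigma_finite_gauss insert.hyps, symmetric])
        measurable
    finally show ?thesis .
  qed
  have cross_j: "(\<integral>w. f w * (w j * S w j) \<partial>?N') = (\<integral>(x, y). F x y * (y * s x y) \<partial>(?N \<Otimes>\<^sub>M gauss1))"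
  proof -
    have "(\<integral>w. f w * (w j * S w j) \<partial>?N') = (\<integral>(x, y). f (x(j := y)) * ((x(j := y)) j * S (x(j := y)) j) \<partial>(?N \<Otimes>\<^sub>M gauss1))"
      by (rule intb) measurable
    also have "\<dots> = (\<integral>(x, y). F x y * (y * s x y) \<partial>(?N \<Otimes>\<^sub>M gauss1))"
      by (rule Bochner_Integration.integral_cong) (auto simp: F_def space_pair_measure S_upd)
    finally show ?thesis .
  qed
  \<comment> \<open>The components of \<open>S\<close> in \<open>I\<close> do not see coordinate
    \<open>j\<close>; integrating it out replaces the joint density by its marginal.\<close>
  have cross_I: "(\<integral>w. f w * (w i * S w i) \<partial>?N') = (\<integral>x. E.marginal x * (x i * S0 x i) \<partial>?N)" if i: "i \<in> I" for i
  proof -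
    have ij: "i \<noteq> j" using that insert.hyps by auto
    have i': "i \<in> insert j I" using i by simp
    have [measurable]: "(\<lambda>w. w i) \<in> borel_measurable ?N'" "(\<lambda>w. S w i) \<in> borel_measurable ?N'"
      using comp[OF i'] measurable_compose[OF S_meas comp[OF i']] by simp_all
    have int: "integrable ?N' (\<lambda>w. f w * (w i * S w i))"
      using i insert.hyps nonneg transport
      by (intro integrable_weighted_product insert.prems(6) transported_sq(1)) (auto simp: S_meas)
    have eq: "(\<lambda>p. case p of (x, y) \<Rightarrow> f (x(j := y)) * ((x(j := y)) i * S (x(j := y)) i)) p
      = (\<lambda>(x, y). F x y * (x i * S0 x i)) p" if "p \<in> space (?N \<Otimes>\<^sub>M gauss1)" for p
      using that ij by (auto simp: F_def space_pair_measure S_upd)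
    have int': "integrable (?N \<Otimes>\<^sub>M gauss1) (\<lambda>(x, y). F x y * (x i * S0 x i))"
      using int by (subst (asm) intb(1), measurable) (subst (asm) Bochner_Integration.integrable_cong[OF refl eq], auto)
    have "(\<integral>w. f w * (w i * S w i) \<partial>?N') = (\<integral>(x, y). f (x(j := y)) * ((x(j := y)) i * S (x(j := y)) i) \<partial>(?N \<Otimes>\<^sub>M gauss1))"
      by (rule intb) measurable
    also have "\<dots> = (\<integral>(x, y). F x y * (x i * S0 x i) \<partial>(?N \<Otimes>\<^sub>M gauss1))"
      by (rule Bochner_Integration.integral_cong[OF refl eq])
    also have "\<dots> = (\<integral>x. E.marginal x * (x i * S0 x i) \<partial>?N)"
      using pair_sigma_finite.integral_fst'[OF E.pair int'] by (simp add: E.marginal_def)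
    finally show ?thesis .
  qed
  have entropy: "(\<Sum>i\<in>insert j I. (\<integral>w. f w * (w i)\<^sup>2 \<partial>?N') / 2 + 1 / 2 - ln (c i)
      - (\<integral>w. f w * (w i * S w i) \<partial>?N') / c i) \<le> (\<integral>w. ent_fn (f w) \<partial>?N')"
    if c: "\<forall>i\<in>insert j I. 0 < c i" for c
  proof -
    have sum_I: "(\<Sum>i\<in>I. (\<integral>w. f w * (w i)\<^sup>2 \<partial>?N') / 2 + 1 / 2 - ln (c i)
        - (\<integral>w. f w * (w i * S w i) \<partial>?N') / c i)
      = (\<Sum>i\<in>I. (\<integral>x. E.marginal x * (x i)\<^sup>2 \<partial>?N) / 2 + 1 / 2 - ln (c i)
        - (\<integral>x. E.marginal x * (x i * S0 x i) \<partial>?N) / c i)"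
      by (rule sum.cong) (simp_all add: comp_sq cross_I)
    have sq_j: "(\<integral>w. f w * (w j)\<^sup>2 \<partial>?N') = (\<integral>(x, y). F x y * y\<^sup>2 \<partial>(?N \<Otimes>\<^sub>M gauss1))"
      by (simp add: intb F_def)
    have ent': "(\<integral>w. ent_fn (f w) \<partial>?N') = (\<integral>(x, y). ent_fn (F x y) \<partial>(?N \<Otimes>\<^sub>M gauss1))"
      by (simp add: intb F_def)
    show ?thesis
      using entropy0[of c] chain(2)[of "c j"] c insert.hyps
      by (simp add: sum_I sq_j ent' cross_j marginal_1)
  qed
  show ?case
    using S_meas transport entropy by blast
qed

section \<open>Spectral theorem for symmetric real matrices\<close>

lemma symmetric_matrix_inner:
  fixes A :: "real ^ 'n ^ 'n"
  assumes "transpose A = A"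
  shows "x \<bullet> (A *v y) = (A *v x) \<bullet> y"
  using assms by (metis dot_lmul_matrix transpose_matrix_vector)

text \<open>First variation: the residual \<open>r = A *v v - c *\<^sub>R v\<close> is orthogonal to
  \<open>v\<close>, and a nonzero residual would be a direction in which the quadratic form
  increases to first order.\<close>

lemma rayleigh_maximizer_eigenvector:
  fixes A :: "real ^ 'n ^ 'n" and v :: "real ^ 'n"
  assumes sym: "transpose A = A" and W: "subspace W" "\<And>x. x \<in> W \<Longrightarrow> A *v x \<in> W"
    and v: "v \<in> W" "norm v = 1"
    and max: "\<And>x. x \<in> W \<Longrightarrow> norm x = 1 \<Longrightarrow> x \<bullet> (A *v x) \<le> v \<bullet> (A *v v)"
  shows "A *v v = (v \<bullet> (A *v v)) *\<^sub>R v"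
proof (rule ccontr)
  assume neq: "\<not> ?thesis"
  define c where "c = v \<bullet> (A *v v)"
  define r where "r = A *v v - c *\<^sub>R v"
  have vv: "v \<bullet> v = 1" using v(2) by (simp add: norm_eq_1)
  have rW: "r \<in> W"
    unfolding r_def using W v by (simp add: subspace_diff subspace_scale)
  have rpos: "0 < r \<bullet> r"
    using neq by (simp add: r_def c_def)
  have rv: "r \<bullet> v = 0" "v \<bullet> r = 0"
    using vv by (simp_all add: r_def c_def inner_diff_left inner_diff_right inner_commute)
  have rAv: "r \<bullet> (A *v v) = r \<bullet> r"
    using rv by (simp add: r_def inner_diff_right)
  have vAr: "v \<bullet> (A *v r) = r \<bullet> r"
    using symmetric_matrix_inner[OF sym, of v r] rAv by (simp add: inner_commute)
  have rayleigh: "x \<bullet> (A *v x) \<le> c * (x \<bullet> x)" if "x \<in> W" for x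
  proof (cases "x = 0")
    case False
    have "(x /\<^sub>R norm x) \<bullet> (A *v (x /\<^sub>R norm x)) \<le> c"
      unfolding c_def using False that W(1) by (intro max) (auto intro: subspace_scale)
    then have "(x \<bullet> (A *v x)) / (norm x)\<^sup>2 \<le> c"
      by (simp add: matrix_vector_mult_scaleR power2_eq_square divide_inverse mult_ac)
    then show ?thesis
      using False by (simp add: power2_norm_eq_inner field_simps)
  qed simp
  define k where "k = c * (r \<bullet> r) - r \<bullet> (A *v r)"
  \<comment> \<open>The Rayleigh bound at \<open>v + t *\<^sub>R r\<close>: the gain is linear in
    \<open>t\<close>, the allowance only quadratic.\<close>
  have quad: "2 * t * (r \<bullet> r) \<le> t\<^sup>2 * k" for t
  proof -
    have "v + t *\<^sub>R r \<in> W"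
      using v(1) rW W(1) by (simp add: subspace_add subspace_scale)
    from rayleigh[OF this] show ?thesis
      using rv vv rAv vAr unfolding c_def[symmetric] k_def
      by (simp add: matrix_vector_right_distrib matrix_vector_mult_scaleR inner_add_left inner_add_right
          c_def[symmetric] power2_eq_square algebra_simps)
  qed
  show False
  proof (cases "k \<le> 0")
    case True
    then show False using quad[of 1] rpos by simp
  next
    case False
    then have "2 * (r \<bullet> r) / k * (r \<bullet> r) \<le> (r \<bullet> r) / k * (r \<bullet> r)"
      using quad[of "(r \<bullet> r) / k"] by (simp add: power2_eq_square)
    moreover have "0 < (r \<bullet> r) / k * (r \<bullet> r)"
      using False rpos by simp
    ultimately show False by simp
  qed
qed

text \<open>By symmetry the orthogonal complement of the eigenvectors in \<open>B\<close> is
  invariant, and it is nontrivial by dimension. The quadratic form attains its maximum on the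
  compact unit sphere of that complement.\<close>

lemma orthonormal_eigenvector_extension:
  fixes A :: "real ^ 'n ^ 'n"
  assumes sym: "transpose A = A" and "finite B" "card B < CARD('n)"
    and eig: "\<And>b. b \<in> B \<Longrightarrow> \<exists>c. A *v b = c *\<^sub>R b"
  obtains v c where "norm v = 1" "A *v v = c *\<^sub>R v" "\<And>b. b \<in> B \<Longrightarrow> b \<bullet> v = 0"
proof -
  define W where "W = {x. \<forall>b\<in>B. b \<bullet> x = 0}"
  have W: "subspace W"
    by (auto simp: W_def subspace_def inner_add_right)
  have AW: "A *v x \<in> W" if "x \<in> W" for x
  proof -
    have "b \<bullet> (A *v x) = 0" if b: "b \<in> B" for b
      using eig[OF b] \<open>x \<in> W\<close> b by (auto simp: symmetric_matrix_inner[OF sym] W_def)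
    then show ?thesis by (simp add: W_def)
  qed
  have "dim B < DIM(real ^ 'n)"
    using dim_le_card'[OF assms(2)] assms(3) by simp
  then obtain x :: "real ^ 'n" where x: "x \<noteq> 0" "\<And>y. y \<in> span B \<Longrightarrow> orthogonal x y"
    using orthogonal_to_subspace_exists by blast
  then have xW: "x \<in> W"
    by (auto simp: W_def orthogonal_def inner_commute span_base)
  define K where "K = sphere 0 1 \<inter> W"
  have "x /\<^sub>R norm x \<in> K"
    using x(1) xW W by (simp add: K_def subspace_scale)
  moreover have "compact K"
    unfolding K_def using closed_subspace[OF W] by (intro compact_Int_closed) simp_all
  moreover have "continuous_on K (\<lambda>x. x \<bullet> (A *v x))"
    by (intro continuous_intros linear_continuous_on) (simp add: matrix_vector_mul_bounded_linear)
  ultimately obtain v where v: "v \<in> K" "\<And>y. y \<in> K \<Longrightarrow> y \<bullet> (A *v y) \<le> v \<bullet> (A *v v)"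
    using continuous_attains_sup[of K "\<lambda>x. x \<bullet> (A *v x)"] by blast
  have "A *v v = (v \<bullet> (A *v v)) *\<^sub>R v"
    by (rule rayleigh_maximizer_eigenvector[OF sym W AW]) (use v in \<open>auto simp: K_def\<close>)
  with v(1) show thesis
    by (intro that[of v]) (auto simp: K_def W_def)
qed

theorem symmetric_matrix_spectral:
  fixes A :: "real ^ 'n ^ 'n"
  assumes sym: "transpose A = A"
  obtains v :: "'n \<Rightarrow> real ^ 'n" and d :: "'n \<Rightarrow> real"
  where "\<And>i j. v i \<bullet> v j = (if i = j then 1 else 0)" "\<And>i. A *v v i = d i *\<^sub>R v i"
proof -
  have "\<exists>B. finite B \<and> card B = k \<and> (\<forall>b\<in>B. norm b = 1 \<and> (\<exists>c. A *v b = c *\<^sub>R b)) \<and>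
      (\<forall>a\<in>B. \<forall>b\<in>B. a \<noteq> b \<longrightarrow> a \<bullet> b = 0)" if "k \<le> CARD('n)" for k
    using that
  proof (induction k)
    case 0
    show ?case by (intro exI[of _ "{}"]) simp
  next
    case (Suc k)
    then obtain B where B: "finite B" "card B = k" "\<And>b. b \<in> B \<Longrightarrow> norm b = 1 \<and> (\<exists>c. A *v b = c *\<^sub>R b)"
      "\<And>a b. a \<in> B \<Longrightarrow> b \<in> B \<Longrightarrow> a \<noteq> b \<Longrightarrow> a \<bullet> b = 0"
      by auto
    obtain v c where v: "norm v = 1" "A *v v = c *\<^sub>R v" "\<And>b. b \<in> B \<Longrightarrow> b \<bullet> v = 0"
      using orthonormal_eigenvector_extension[OF sym B(1)] B(2,3) Suc.prems by (metis Suc_le_lessD)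
    have "v \<notin> B"
      using v(1) v(3)[of v] by auto
    with B v show ?case
      by (intro exI[of _ "insert v B"]) (auto simp: inner_commute)
  qed
  from this[OF order_refl] obtain B where B: "finite B" "card B = CARD('n)"
    "\<And>b. b \<in> B \<Longrightarrow> norm b = 1 \<and> (\<exists>c. A *v b = c *\<^sub>R b)"
    "\<And>a b. a \<in> B \<Longrightarrow> b \<in> B \<Longrightarrow> a \<noteq> b \<Longrightarrow> a \<bullet> b = 0"
    by auto
  obtain v where v: "bij_betw v (UNIV :: 'n set) B"
    using finite_same_card_bij[of "UNIV :: 'n set" B] B by auto
  have vB: "v i \<in> B" for i
    using v by (auto simp: bij_betw_def)
  have vinj: "i \<noteq> j \<Longrightarrow> v i \<noteq> v j" for i j
    using v by (auto simp: bij_betw_def inj_on_def)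
  obtain d where d: "\<And>i. A *v v i = d i *\<^sub>R v i"
    using B(3)[OF vB] by metis
  show thesis
    by (rule that[of v d]) (use B vB vinj d in \<open>auto simp: norm_eq_1\<close>)
qed

section \<open>Characteristic polynomial and eigenvalues with multiplicity\<close>

definition const_poly_matrix :: "'a::comm_ring_1 ^ 'n ^ 'm \<Rightarrow> 'a poly ^ 'n ^ 'm" where
  "const_poly_matrix A = (\<chi> i j. [:A $ i $ j:])"

lemma sum_const_poly: "(\<Sum>i\<in>I. [:f i:]) = [:\<Sum>i\<in>I. f i:]"
  by (induction I rule: infinite_finite_induct) auto

lemma const_poly_matrix_mult:
  "const_poly_matrix (A ** B) = const_poly_matrix A ** const_poly_matrix B"
  by (simp add: const_poly_matrix_def matrix_matrix_mult_def vec_eq_iff sum_const_poly[symmetric] mult.commute)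

lemma const_poly_matrix_mat_1: "const_poly_matrix (mat 1) = mat 1"
  by (simp add: const_poly_matrix_def mat_def vec_eq_iff one_pCons)

text \<open>With the eigenvectors as columns of \<open>P\<close>, the characteristic matrices of
  \<open>A\<close> and of the diagonal matrix \<open>D\<close> are conjugate over the polynomials.
  The determinant of \<open>P\<close> cancels because \<open>P\<close> is orthogonal.\<close>

lemma char_polynomial_orthonormal_eigenbasis:
  fixes A :: "real ^ 'n ^ 'n" and v :: "'n \<Rightarrow> real ^ 'n"
  assumes orth: "\<And>i j. v i \<bullet> v j = (if i = j then 1 else 0)" and eig: "\<And>i. A *v v i = d i *\<^sub>R v i"
  shows "char_polynomial A = (\<Prod>i\<in>UNIV. [:- d i, 1:])"
proof -
  define P :: "real ^ 'n ^ 'n" where "P = (\<chi> i j. v j $ i)"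
  define D :: "real ^ 'n ^ 'n" where "D = (\<chi> i j. if i = j then d i else 0)"
  define X :: "real poly ^ 'n ^ 'n" where "X = mat [:0, 1:]"
  have AP: "A ** P = P ** D"
  proof -
    have "(A ** P) $ i $ j = (P ** D) $ i $ j" for i j
    proof -
      have "(A ** P) $ i $ j = (A *v v j) $ i"
        by (simp add: matrix_matrix_mult_def matrix_vector_mult_def P_def)
      also have "\<dots> = d j * v j $ i"
        by (simp add: eig)
      also have "\<dots> = (P ** D) $ i $ j"
        by (simp add: matrix_matrix_mult_def P_def D_def if_distrib cong: if_cong)
      finally show ?thesis .
    qed
    then show ?thesis by (simp add: vec_eq_iff)
  qed
  have PP: "transpose P ** P = mat 1"
    using orth by (simp add: vec_eq_iff matrix_matrix_mult_def transpose_def P_def mat_def inner_vec_def)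
  have XP: "X ** const_poly_matrix P = const_poly_matrix P ** X"
    by (simp add: vec_eq_iff matrix_matrix_mult_def X_def mat_def if_distrib if_distribR mult.commute cong: if_cong)
  have "det (const_poly_matrix (transpose P)) * det (const_poly_matrix P) = 1"
    by (simp add: det_mul[symmetric] const_poly_matrix_mult[symmetric] PP const_poly_matrix_mat_1)
  then have nz: "det (const_poly_matrix P) \<noteq> 0"
    by auto
  have "char_polynomial A * det (const_poly_matrix P) = det ((X - const_poly_matrix A) ** const_poly_matrix P)"
    by (simp add: char_polynomial_def X_def const_poly_matrix_def det_mul)
  also have "(X - const_poly_matrix A) ** const_poly_matrix P = const_poly_matrix P ** (X - const_poly_matrix D)"
  proof -
    have "(X - const_poly_matrix A) ** const_poly_matrix P = X ** const_poly_matrix P - const_poly_matrix (A ** P)"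
      unfolding const_poly_matrix_mult
      by (simp add: vec_eq_iff matrix_matrix_mult_def left_diff_distrib sum_subtractf)
    also have "\<dots> = const_poly_matrix P ** (X - const_poly_matrix D)"
      unfolding XP AP const_poly_matrix_mult
      by (simp add: vec_eq_iff matrix_matrix_mult_def right_diff_distrib sum_subtractf)
    finally show ?thesis .
  qed
  also have "det (const_poly_matrix P ** (X - const_poly_matrix D)) =
      (\<Prod>i\<in>UNIV. (X - const_poly_matrix D) $ i $ i) * det (const_poly_matrix P)"
    unfolding det_mul by (subst (2) det_diagonal) (simp_all add: X_def D_def const_poly_matrix_def mat_def mult.commute)
  also have "(\<Prod>i\<in>UNIV. (X - const_poly_matrix D) $ i $ i) = (\<Prod>i\<in>UNIV. [:- d i, 1:])"
    by (simp add: X_def D_def const_poly_matrix_def mat_def)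
  finally show ?thesis
    using nz by simp
qed

text \<open>Equal products have equal multisets of roots, so the order of the enumeration is
  immaterial.\<close>

lemma sum_over_roots_cong:
  fixes l d :: "'n::finite \<Rightarrow> real" and g :: "real \<Rightarrow> 'b::comm_monoid_add"
  assumes "(\<Prod>i\<in>UNIV. [:- l i, 1:]) = (\<Prod>i\<in>UNIV. [:- d i, 1:])"
  shows "(\<Sum>i\<in>UNIV. g (l i)) = (\<Sum>i\<in>UNIV. g (d i))"
proof -
  have roots: "proots (\<Prod>i\<in>UNIV. [:- m i, 1:]) = image_mset m (mset_set UNIV)" for m :: "'n \<Rightarrow> real"
    by (subst proots_prod) (auto simp: sum_unfold_sum_mset)
  have "image_mset g (image_mset l (mset_set UNIV)) = image_mset g (image_mset d (mset_set UNIV))"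
    using arg_cong[OF assms, of proots] by (simp only: roots)
  then show ?thesis
    by (simp add: sum_unfold_sum_mset image_mset.compositionality comp_def)
qed

section \<open>Rotation invariance of the Gaussian measure\<close>

lemma nn_integral_lborel_shift:
  fixes c :: "'a::euclidean_space"
  assumes [measurable]: "f \<in> borel_measurable borel"
  shows "(\<integral>\<^sup>+x. f (x + c) \<partial>lborel) = (\<integral>\<^sup>+x. f x \<partial>lborel)"
proof -
  have "(\<integral>\<^sup>+x. f x \<partial>lborel) = (\<integral>\<^sup>+x. f x \<partial>distr lborel borel ((+) c))"
    by (simp add: lborel_distr_plus)
  also have "\<dots> = (\<integral>\<^sup>+x. f (c + x) \<partial>lborel)"
    by (rule nn_integral_distr) auto
  finally show ?thesis by (simp add: add.commute)
qed

text \<open>As in the uniqueness proof for Haar measure: comparing with a ball, which is invariant,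
  fixes the constant.\<close>

lemma distr_lborel_orthogonal:
  fixes f g :: "'a::euclidean_space \<Rightarrow> 'a"
  assumes lin: "linear f" and iso: "\<And>x. norm (f x) = norm x" and inv: "\<And>x. f (g x) = x"
  shows "distr lborel borel f = lborel"
proof (rule measure_eqI)
  fix B assume "B \<in> sets (distr lborel borel f)"
  then have [measurable]: "B \<in> sets borel" by simp
  have [measurable]: "f \<in> borel_measurable borel"
    using lin by (intro borel_measurable_continuous_onI linear_continuous_on linear_conv_bounded_linear[THEN iffD1])
  define A where "A = ball (0::'a) 1"
  have [measurable]: "A \<in> sets borel" by (simp add: A_def)
  have dist_f: "dist (f x) (f y) = dist x y" for x y
    using iso[of "x - y"] lin by (simp add: dist_norm linear_diff)
  have A: "emeasure lborel A \<noteq> 0" "emeasure lborel A \<noteq> \<infinity>"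
    using emeasure_lborel_ball_finite[of "0::'a" 1] content_ball_pos[of 1 "0::'a"]
    by (auto simp: A_def emeasure_eq_ennreal_measure)
  have "emeasure lborel A * emeasure (distr lborel borel f) B
      = (\<integral>\<^sup>+x. indicator A x * (\<integral>\<^sup>+y. indicator B (f y) \<partial>lborel) \<partial>lborel)"
  proof -
    have "emeasure (distr lborel borel f) B = (\<integral>\<^sup>+y. indicator B y \<partial>distr lborel borel f)"
      by simp
    also have "\<dots> = (\<integral>\<^sup>+y. indicator B (f y) \<partial>lborel)"
      by (rule nn_integral_distr) auto
    finally show ?thesis
      by (simp add: nn_integral_multc)
  qed
  \<comment> \<open>Since \<open>f y + x = f (y + g x)\<close>, translation invariance in
    \<open>y\<close> absorbs the shift by \<open>x\<close>.\<close>
  also have "\<dots> = (\<integral>\<^sup>+x. \<integral>\<^sup>+y. indicator A x * indicator B (f y + x) \<partial>lborel \<partial>lborel)"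
  proof (rule nn_integral_cong)
    fix x
    have "(\<integral>\<^sup>+y. indicator B (f y + x) \<partial>lborel) = (\<integral>\<^sup>+y. indicator B (f (y + g x)) \<partial>lborel)"
      using lin inv by (simp add: linear_add)
    also have "\<dots> = (\<integral>\<^sup>+y. indicator B (f y) \<partial>lborel)"
      by (rule nn_integral_lborel_shift[where f = "\<lambda>y. indicator B (f y)"]) measurable
    finally show "indicator A x * (\<integral>\<^sup>+y. indicator B (f y) \<partial>lborel)
        = (\<integral>\<^sup>+y. indicator A x * indicator B (f y + x) \<partial>lborel)"
      by (subst nn_integral_cmult) auto
  qed
  also have "\<dots> = (\<integral>\<^sup>+y. \<integral>\<^sup>+x. indicator A x * indicator B (f y + x) \<partial>lborel \<partial>lborel)"
    by (rule lborel_pair.Fubini') measurable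
  also have "\<dots> = (\<integral>\<^sup>+y. \<integral>\<^sup>+x. indicator A (x - f y) * indicator B x \<partial>lborel \<partial>lborel)"
  proof (rule nn_integral_cong)
    fix y
    show "(\<integral>\<^sup>+x. indicator A x * indicator B (f y + x) \<partial>lborel)
        = (\<integral>\<^sup>+x. indicator A (x - f y) * indicator B x \<partial>lborel)"
      using nn_integral_lborel_shift[of "\<lambda>x. indicator A (x - f y) * indicator B x" "f y"]
      by (simp add: add.commute)
  qed
  also have "\<dots> = (\<integral>\<^sup>+x. \<integral>\<^sup>+y. indicator A (x - f y) * indicator B x \<partial>lborel \<partial>lborel)"
    by (rule lborel_pair.Fubini') measurable
  also have "\<dots> = (\<integral>\<^sup>+x. emeasure lborel A * indicator B x \<partial>lborel)"
  proof (rule nn_integral_cong)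
    fix x
    \<comment> \<open>Here the invariance of the ball enters: \<open>x - f y = f (g x - y)\<close>
      has the same norm as \<open>y - g x\<close>.\<close>
    have "indicator A (x - f y) = (indicator A (y - g x) :: ennreal)" for y
      using dist_f[of "g x" y] inv[of x]
      by (auto simp: A_def dist_norm norm_minus_commute split: split_indicator)
    then have "(\<integral>\<^sup>+y. indicator A (x - f y) \<partial>lborel) = (\<integral>\<^sup>+y. indicator A (y + - g x) \<partial>lborel)"
      by simp
    also have "\<dots> = (\<integral>\<^sup>+y. indicator A y \<partial>lborel)"
      by (rule nn_integral_lborel_shift) measurable
    finally show "(\<integral>\<^sup>+y. indicator A (x - f y) * indicator B x \<partial>lborel) = emeasure lborel A * indicator B x"
      by (simp add: nn_integral_multc)
  qed
  also have "\<dots> = emeasure lborel A * emeasure lborel B"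
    by (simp add: nn_integral_cmult)
  finally show "emeasure (distr lborel borel f) B = emeasure lborel B"
    using A by (simp add: ennreal_mult_cancel_left)
qed simp

section \<open>The standard Gaussian in orthonormal coordinates\<close>

lemma sets_std_gaussian [simp, measurable_cong]: "sets std_gaussian = sets borel"
  by (simp add: std_gaussian_def)

lemma space_std_gaussian [simp]: "space std_gaussian = UNIV"
  by (simp add: std_gaussian_def)

lemma measurable_vec_nth [measurable]: "(\<lambda>x :: real ^ 'n. x $ i) \<in> borel_measurable borel"
  by (intro borel_measurable_continuous_onI continuous_intros)

text \<open>The density depends on \<open>x\<close> only through its norm, which is the source of
  rotation invariance.\<close>

lemma prod_std_normal_density:
  fixes x :: "real ^ 'n"
  shows "(\<Prod>i\<in>UNIV. std_normal_density (x $ i)) = (1 / sqrt (2 * pi)) ^ CARD('n) * exp (- (norm x)\<^sup>2 / 2)"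
proof -
  have "(norm x)\<^sup>2 = (\<Sum>i\<in>UNIV. (x $ i)\<^sup>2)"
    unfolding power2_norm_eq_inner by (simp add: inner_vec_def power2_eq_square)
  then have "(\<Sum>i\<in>UNIV. - (x $ i)\<^sup>2 / 2) = - (norm x)\<^sup>2 / 2"
    by (simp add: sum_negf sum_divide_distrib)
  then show ?thesis
    by (simp add: std_normal_density_def prod.distrib prod_dividef power_divide flip: exp_sum)
qed

lemma distr_std_gaussian_orthogonal:
  fixes f g :: "real ^ 'n \<Rightarrow> real ^ 'n"
  assumes lin: "linear f" and iso: "\<And>x. norm (f x) = norm x" and inv: "\<And>x. f (g x) = x"
  shows "distr std_gaussian borel f = std_gaussian"
proof -
  define h :: "real ^ 'n \<Rightarrow> ennreal" where "h x = ennreal (\<Prod>i\<in>UNIV. std_normal_density (x $ i))" for x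
  have [measurable]: "f \<in> borel_measurable borel"
    using lin by (intro borel_measurable_continuous_onI linear_continuous_on linear_conv_bounded_linear[THEN iffD1])
  have [measurable]: "h \<in> borel_measurable borel"
    unfolding h_def[abs_def] by measurable
  have "h (f x) = h x" for x
    by (simp add: h_def prod_std_normal_density iso)
  then have "distr std_gaussian borel f = distr (density lborel (\<lambda>x. h (f x))) borel f"
    by (simp add: std_gaussian_def h_def[abs_def])
  also have "\<dots> = density (distr lborel borel f) h"
    by (rule density_distr[symmetric]) auto
  also have "\<dots> = std_gaussian"
    unfolding distr_lborel_orthogonal[OF lin iso inv] by (simp add: std_gaussian_def h_def[abs_def])
  finally show ?thesis .
qed

text \<open>Both measures are compared on boxes, where the Lebesgue integral factors over the
  standard basis.\<close>

lemma distr_std_gaussian_coordinates: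
  "distr (std_gaussian :: (real ^ 'n) measure) (gauss_prod UNIV) (\<lambda>x i. x $ i) = gauss_prod UNIV" (is "?D = _")
proof (rule product_sigma_finite.PiM_eqI[OF product_sigma_finite_gauss])
  have coord [measurable]: "(\<lambda>(x :: real ^ 'n) i. x $ i) \<in> measurable borel (gauss_prod UNIV)"
    by (rule measurable_PiM_single') auto
  then have coord': "(\<lambda>(x :: real ^ 'n) i. x $ i) \<in> measurable std_gaussian (gauss_prod UNIV)"
    by (simp cong: measurable_cong_sets)
  have prod_Basis: "(\<Prod>b\<in>Basis. F b) = (\<Prod>i\<in>UNIV. F (axis i 1))" for F :: "real ^ 'n \<Rightarrow> ennreal"
  proof -
    have B: "(Basis :: (real ^ 'n) set) = range (\<lambda>i. axis i 1)"
      by (auto simp: Basis_vec_def)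
    have "inj (\<lambda>i. axis i 1 :: real ^ 'n)"
      by (auto simp: inj_on_def axis_eq_axis)
    then show ?thesis
      unfolding B by (simp add: prod.reindex)
  qed
  fix E :: "'n \<Rightarrow> real set" assume "\<And>i. i \<in> UNIV \<Longrightarrow> E i \<in> sets gauss1"
  then have E [measurable]: "\<And>i. E i \<in> sets borel" by simp
  have "emeasure ?D (Pi\<^sub>E UNIV E) = emeasure std_gaussian ((\<lambda>x i. x $ i) -` Pi\<^sub>E UNIV E \<inter> space std_gaussian)"
    by (rule emeasure_distr[OF coord' sets_PiM_I_finite]) auto
  also have "(\<lambda>x i. x $ i) -` Pi\<^sub>E UNIV E \<inter> space std_gaussian = {x :: real ^ 'n. \<forall>i. x $ i \<in> E i}"
    by auto
  also have "emeasure std_gaussian {x :: real ^ 'n. \<forall>i. x $ i \<in> E i}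
      = (\<integral>\<^sup>+(x :: real ^ 'n). (\<Prod>b\<in>Basis. ennreal (std_normal_density (x \<bullet> b)) * indicator (E (axis_index b)) (x \<bullet> b)) \<partial>lborel)"
    unfolding std_gaussian_def
    by (subst emeasure_density)
      (auto intro!: nn_integral_cong simp: prod_Basis inner_axis prod.distrib prod_ennreal split: split_indicator)
  also have "\<dots> = (\<Prod>b\<in>(Basis :: (real ^ 'n) set). \<integral>\<^sup>+y. ennreal (std_normal_density y) * indicator (E (axis_index b)) y \<partial>lborel)"
    by (rule nn_integral_lborel_prod) auto
  also have "\<dots> = (\<Prod>i\<in>UNIV. emeasure gauss1 (E i))"
    unfolding prod_Basis by (simp add: gauss1_def emeasure_density)
  finally show "emeasure ?D (Pi\<^sub>E UNIV E) = (\<Prod>i\<in>UNIV. emeasure gauss1 (E i))" .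
qed auto

text \<open>Rotation invariance lets independent Gaussian coordinates be taken along any orthonormal
  basis, in particular along the eigenvectors of the covariance.\<close>

lemma distr_gauss_prod_orthonormal:
  fixes v :: "'n \<Rightarrow> real ^ 'n"
  assumes orth: "\<And>i j. v i \<bullet> v j = (if i = j then 1 else 0)"
  shows "distr (gauss_prod UNIV) borel (\<lambda>y. \<Sum>i\<in>UNIV. y i *\<^sub>R v i) = std_gaussian"
proof -
  define f :: "real ^ 'n \<Rightarrow> real ^ 'n" where "f x = (\<Sum>i\<in>UNIV. x $ i *\<^sub>R v i)" for x
  have lin: "linear f"
    by (auto simp: linear_iff f_def algebra_simps sum.distrib scaleR_sum_right)
  have iso: "norm (f x) = norm x" for x
  proof -
    have "f x \<bullet> f x = (\<Sum>i\<in>UNIV. x $ i * x $ i)"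
      by (simp add: f_def inner_sum_left inner_sum_right orth if_distrib cong: if_cong)
    also have "\<dots> = x \<bullet> x"
      by (simp add: inner_vec_def)
    finally show ?thesis
      by (simp add: norm_eq)
  qed
  have "surj f"
  proof (rule linear_injective_imp_surjective[OF lin])
    show "inj f"
      using iso by (auto simp: linear_injective_0[OF lin]) (metis norm_eq_zero)
  qed simp
  then obtain g where inv: "\<And>x. f (g x) = x"
    by (metis surj_def)
  have [measurable]: "(\<lambda>(x :: real ^ 'n) i. x $ i) \<in> measurable std_gaussian (gauss_prod UNIV)"
    by (rule measurable_PiM_single') auto
  have [measurable]: "(\<lambda>y. \<Sum>i\<in>UNIV. y i *\<^sub>R v i) \<in> borel_measurable (gauss_prod UNIV)"
    by measurable
  have "distr (gauss_prod UNIV) borel (\<lambda>y. \<Sum>i\<in>UNIV. y i *\<^sub>R v i)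
      = distr (distr std_gaussian (gauss_prod UNIV) (\<lambda>x i. x $ i)) borel (\<lambda>y. \<Sum>i\<in>UNIV. y i *\<^sub>R v i)"
    by (simp add: distr_std_gaussian_coordinates)
  also have "\<dots> = distr std_gaussian borel f"
    by (subst distr_distr) (auto simp: comp_def f_def[abs_def])
  also have "\<dots> = std_gaussian"
    by (rule distr_std_gaussian_orthogonal[OF lin iso inv])
  finally show ?thesis .
qed

section \<open>The deficit\<close>

text \<open>The function \<open>2 * ln t - t + 1 / t\<close> vanishes at 1 and has derivative
  \<open>- ((1 - 1 / t)\<^sup>2)\<close>, so it is nonnegative on the given range.\<close>

lemma two_mult_ln_ge:
  assumes "0 < t" "t \<le> 1"
  shows "t\<^sup>2 - 1 \<le> 2 * t * ln (t :: real)"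
proof -
  have "2 * ln 1 - 1 + 1 / 1 \<le> 2 * ln t - t + 1 / t"
  proof (rule DERIV_nonpos_imp_nonincreasing[OF assms(2)])
    fix x assume x: "t \<le> x" "x \<le> 1"
    have "((\<lambda>x. 2 * ln x - x + 1 / x) has_real_derivative - ((1 - 1 / x)\<^sup>2)) (at x)"
      using x assms by (auto intro!: derivative_eq_intros simp: power2_eq_square field_simps)
    then show "\<exists>y. ((\<lambda>x. 2 * ln x - x + 1 / x) has_real_derivative y) (at x) \<and> y \<le> 0"
      by (intro exI conjI) auto
  qed
  then have "0 \<le> t * (2 * ln t - t + 1 / t)"
    using assms(1) by simp
  then show ?thesis
    using assms(1) by (simp add: algebra_simps power2_eq_square)
qed

text \<open>For \<open>r < 1\<close> the factor \<open>1 - 1 / c\<close> is negative, so the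
  right-hand side is smallest at \<open>a = sqrt r\<close>, where it is the Gaussian deficit.
  Clearing the denominator reduces the comparison to \<open>two_mult_ln_ge\<close>. For
  \<open>r \<ge> 1\<close> both sides are 0.\<close>

lemma deficit_term_le:
  fixes a r :: real
  assumes "0 < r" "a \<le> sqrt r" and c: "c = min 1 (sqrt r)"
  shows "deficit_term r \<le> ereal (2 * a * (1 - 1 / c) - 2 * ln c)"
proof (cases "r < 1")
  case True
  define t where "t = sqrt r"
  have t: "0 < t" "t < 1" "r = t\<^sup>2"
    using assms(1) True by (simp_all add: t_def)
  have "(2 * (1 - t\<^sup>2) + (t\<^sup>2 + 1) * (2 * ln t)) / (t\<^sup>2 - 1) \<le> 2 * t - 2 - 2 * ln t"
  proof -
    have "0 < 1 - t\<^sup>2"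
      using t by (simp add: power_less_one_iff)
    moreover have "t * (t\<^sup>2 - 1) \<le> t * (2 * t * ln t)"
      using two_mult_ln_ge[of t] t by (intro mult_left_mono) auto
    ultimately show ?thesis
      by (subst neg_divide_le_eq) (simp_all add: algebra_simps power2_eq_square)
  qed
  also have "\<dots> = 2 * t * (1 - 1 / t) - 2 * ln t"
    using t by (simp add: algebra_simps)
  also have "\<dots> \<le> 2 * a * (1 - 1 / t) - 2 * ln t"
    using t assms(2) by (auto simp: t_def[symmetric] intro!: mult_right_mono_neg)
  finally show ?thesis
    using t True c by (simp add: deficit_term_def ln_realpow t_def[symmetric])
next
  case False
  then show ?thesis by (simp add: deficit_term_def c)
qed

text \<open>If all \<open>d i\<close> are positive, the choice of \<open>c\<close> above works
  termwise. If some \<open>d j = 0\<close>, the left-hand sum is infinite, and the hypothesis on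
  \<open>V\<close> is refuted by letting \<open>c j\<close> be small.\<close>

lemma sum_deficit_term_le:
  fixes a d :: "'i::finite \<Rightarrow> real"
  assumes d: "\<And>i. 0 \<le> d i" and a: "\<And>i. a i \<le> sqrt (d i)"
    and V: "\<And>c. (\<And>i. 0 < c i) \<Longrightarrow> (\<Sum>i\<in>UNIV. 2 * a i * (1 - 1 / c i) - 2 * ln (c i)) \<le> V"
  shows "(\<Sum>i\<in>UNIV. deficit_term (d i)) \<le> ereal V"
proof (cases "\<forall>i. 0 < d i")
  case True
  define c where "c i = min 1 (sqrt (d i))" for i
  have "(\<Sum>i\<in>UNIV. deficit_term (d i)) \<le> (\<Sum>i\<in>UNIV. ereal (2 * a i * (1 - 1 / c i) - 2 * ln (c i)))"
    by (intro sum_mono deficit_term_le) (use True a in \<open>auto simp: c_def\<close>)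
  also have "\<dots> \<le> ereal V"
    using V[of c] True by (simp add: c_def)
  finally show ?thesis .
next
  case False
  then obtain j where j: "d j = 0"
    using d by (metis order_le_less)
  \<comment> \<open>Small enough that \<open>- 2 * ln e\<close> alone exceeds
    \<open>V\<close>.\<close>
  define e where "e = exp (- (\<bar>V\<bar> + 1))"
  have e: "0 < e" "e < 1" "- 2 * ln e = 2 * \<bar>V\<bar> + 2"
    by (simp_all add: e_def)
  define c where "c i = (if d i = 0 then e else min 1 (sqrt (d i)))" for i
  have c: "0 < c i" "c i \<le> 1" for i
    using e d[of i] by (auto simp: c_def)
  have term_le: "- 2 * ln (c i) + 2 * sqrt (d i) * (1 - 1 / c i) \<le> 2 * a i * (1 - 1 / c i) - 2 * ln (c i)" for i
  proof -
    have "1 - 1 / c i \<le> 0" using c[of i] by simp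
    then have "sqrt (d i) * (1 - 1 / c i) \<le> a i * (1 - 1 / c i)"
      using a by (rule mult_right_mono_neg[rotated])
    then show ?thesis by simp
  qed
  \<comment> \<open>With every summand nonnegative, the large one at \<open>j\<close> is bounded by
    the whole sum.\<close>
  have nonneg: "0 \<le> 2 * a i * (1 - 1 / c i) - 2 * ln (c i)" for i
  proof (cases "d i = 0")
    case True
    then show ?thesis using term_le[of i] e by (simp add: c_def)
  next
    case False
    then have "0 < d i" using d[of i] by simp
    have "0 \<le> - 2 * ln (c i) + 2 * sqrt (d i) * (1 - 1 / c i)"
    proof (cases "d i < 1")
      case True
      then have "c i = sqrt (d i)" using False by (simp add: c_def)
      then show ?thesis
        using ln_le_minus_one[of "c i"] c[of i] by (simp add: algebra_simps)
    next
      case False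
      then have "c i = 1" by (simp add: c_def)
      then show ?thesis by simp
    qed
    then show ?thesis using term_le[of i] by linarith
  qed
  have "V < 2 * \<bar>V\<bar> + 2" by linarith
  also have "\<dots> \<le> 2 * a j * (1 - 1 / c j) - 2 * ln (c j)"
    using term_le[of j] j e by (simp add: c_def)
  also have "\<dots> \<le> (\<Sum>i\<in>UNIV. 2 * a i * (1 - 1 / c i) - 2 * ln (c i))"
    by (rule member_le_sum) (use nonneg in auto)
  also have "\<dots> \<le> V"
    by (rule V) (rule c)
  finally show ?thesis by simp
qed

section \<open>Couplings, covariance and finite entropy\<close>

lemma transport_cost_le:
  fixes X Y :: "'b \<Rightarrow> 'a::euclidean_space"
  assumes "prob_space P" and [measurable]: "X \<in> borel_measurable P" "Y \<in> borel_measurable P"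
    and X: "distr P borel X = M" and Y: "distr P borel Y = N"
  shows "transport_cost M N \<le> (\<integral>\<^sup>+\<omega>. ennreal ((norm (X \<omega> - Y \<omega>))\<^sup>2) \<partial>P)"
proof -
  have sets [measurable_cong]: "sets M = sets borel" "sets N = sets borel"
    using X Y by auto
  define Q where "Q = distr P (borel \<Otimes>\<^sub>M borel) (\<lambda>\<omega>. (X \<omega>, Y \<omega>))"
  have "Q \<in> couplings M N"
    unfolding couplings_def mem_Collect_eq
  proof (intro conjI)
    show "prob_space Q"
      unfolding Q_def using assms(1) by (rule prob_space.prob_space_distr) measurable
    have "sets (M \<Otimes>\<^sub>M N) = sets (borel \<Otimes>\<^sub>M borel)"
      using sets by (rule sets_pair_measure_cong)
    then show "sets Q = sets (M \<Otimes>\<^sub>M N)"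
      by (simp add: Q_def)
    have "distr Q M fst = distr Q borel fst"
      by (rule distr_cong) (simp_all add: sets)
    also have "\<dots> = M"
      unfolding Q_def by (subst distr_distr) (auto simp: comp_def X)
    finally show "distr Q M fst = M" .
    have "distr Q N snd = distr Q borel snd"
      by (rule distr_cong) (simp_all add: sets)
    also have "\<dots> = N"
      unfolding Q_def by (subst distr_distr) (auto simp: comp_def Y)
    finally show "distr Q N snd = N" .
  qed
  then have "transport_cost M N \<le> (\<integral>\<^sup>+(x, y). ennreal ((norm (x - y))\<^sup>2) \<partial>Q)"
    unfolding transport_cost_def by (rule INF_lower)
  also have "\<dots> = (\<integral>\<^sup>+\<omega>. ennreal ((norm (X \<omega> - Y \<omega>))\<^sup>2) \<partial>P)"
    unfolding Q_def by (subst nn_integral_distr) auto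
  finally show ?thesis .
qed

lemma wasserstein2_sq_le:
  assumes "transport_cost M N \<le> ennreal K" "0 \<le> K"
  obtains W where "(wasserstein2 M N)\<^sup>2 = ereal W" "W \<le> K"
proof (rule that)
  have "transport_cost M N \<noteq> \<infinity>"
    using assms(1) by (auto simp: top_unique)
  then show "(wasserstein2 M N)\<^sup>2 = ereal (enn2real (transport_cost M N))"
    by (simp add: wasserstein2_def)
  show "enn2real (transport_cost M N) \<le> K"
    using assms by (rule enn2real_leI[rotated])
qed

text \<open>For a centered measure the covariance entries are plain second moments; expanding the
  square gives the quadratic form.\<close>

lemma covariance_quadratic_form:
  fixes \<mu> :: "(real ^ 'd) measure"
  assumes sets [measurable_cong]: "sets \<mu> = sets borel" and sq: "integrable \<mu> (\<lambda>x. (norm x)\<^sup>2)"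
    and "mean \<mu> = 0"
  shows "integrable \<mu> (\<lambda>x. (w \<bullet> x)\<^sup>2)" "(\<integral>x. (w \<bullet> x)\<^sup>2 \<partial>\<mu>) = w \<bullet> (covariance_matrix \<mu> *v w)"
proof -
  have int: "integrable \<mu> (\<lambda>x. x $ i * x $ j)" for i j
  proof (rule Bochner_Integration.integrable_bound[OF sq])
    show "AE x in \<mu>. norm (x $ i * x $ j) \<le> norm ((norm x)\<^sup>2)"
      by (intro AE_I2) (auto simp: abs_mult power2_eq_square intro!: mult_mono component_le_norm_cart)
  qed measurable
  have eq: "(w \<bullet> x)\<^sup>2 = (\<Sum>i\<in>UNIV. \<Sum>j\<in>UNIV. w $ i * w $ j * (x $ i * x $ j))" for x
    by (simp add: inner_vec_def power2_eq_square sum_product mult_ac)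
  show "integrable \<mu> (\<lambda>x. (w \<bullet> x)\<^sup>2)"
    unfolding eq using int by auto
  have "(\<integral>x. (w \<bullet> x)\<^sup>2 \<partial>\<mu>) = (\<Sum>i\<in>UNIV. \<Sum>j\<in>UNIV. w $ i * w $ j * (\<integral>x. x $ i * x $ j \<partial>\<mu>))"
    unfolding eq using int by simp
  also have "\<dots> = w \<bullet> (covariance_matrix \<mu> *v w)"
    using assms(3) by (simp add: covariance_matrix_def inner_vec_def matrix_vector_mult_def sum_distrib_left mult_ac)
  finally show "(\<integral>x. (w \<bullet> x)\<^sup>2 \<partial>\<mu>) = w \<bullet> (covariance_matrix \<mu> *v w)" .
qed

text \<open>Finiteness selects the first branch of \<open>rel_entropy\<close>, hence absolute
  continuity and an integrable logarithm. A real-valued, everywhere nonnegative version of the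
  Radon-Nikodym derivative is then chosen.\<close>

lemma finite_rel_entropy_density:
  assumes "prob_space N" and M: "prob_space M" and sets: "sets M = sets N" and fin: "rel_entropy M N \<noteq> \<infinity>"
  obtains f where "f \<in> borel_measurable N" "\<And>x. 0 \<le> f x" "M = density N (\<lambda>x. ennreal (f x))"
    "integrable N (\<lambda>x. f x * ln (f x))" "rel_entropy M N = ereal (\<integral>x. f x * ln (f x) \<partial>N)"
proof -
  interpret N: prob_space N by fact
  interpret M: prob_space M by fact
  have ac: "absolutely_continuous N M" and int: "integrable M (entropy_density (exp 1) N M)"
    using fin by (auto simp: rel_entropy_def split: if_splits)
  obtain f where f [measurable]: "f \<in> borel_measurable N" and RN: "AE x in N. RN_deriv N M x = ennreal (f x)"
    and nn: "\<And>x. 0 \<le> f x"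
    using N.real_RN_deriv[OF M.finite_measure_axioms ac sets] by metis
  have M_eq: "M = density N (\<lambda>x. ennreal (f x))"
    using N.density_RN_deriv[OF ac sets] RN by (subst density_cong[of _ _ "RN_deriv N M"]) auto
  have log: "log (exp 1) x = ln x" for x :: real
    by (simp add: log_def)
  have "AE x in M. entropy_density (exp 1) N M x = ln (f x)"
    using absolutely_continuous_AE[OF sets ac RN] by eventually_elim (simp add: entropy_density_def log nn)
  moreover have [measurable]: "entropy_density (exp 1) N M \<in> borel_measurable M" "(\<lambda>x. ln (f x)) \<in> borel_measurable M"
    using sets by (simp_all cong: measurable_cong_sets)
  ultimately have "integrable M (\<lambda>x. ln (f x))"
    using int by (subst (asm) integrable_cong_AE) auto
  then have "integrable N (\<lambda>x. f x * ln (f x))"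
    using nn by (subst (asm) M_eq, subst (asm) integrable_density) auto
  moreover have "rel_entropy M N = ereal (\<integral>x. f x * ln (f x) \<partial>N)"
    using ac int N.KL_density[of "exp 1" f] nn by (simp add: rel_entropy_def log flip: M_eq)
  ultimately show thesis
    using that f nn M_eq by blast
qed

lemma prob_space_std_gaussian: "prob_space (std_gaussian :: (real ^ 'd) measure)"
proof -
  have orth: "axis i 1 \<bullet> (axis j 1 :: real ^ 'd) = (if i = j then 1 else 0)" for i j
    by (simp add: inner_axis_axis)
  have "prob_space (distr (gauss_prod UNIV) borel (\<lambda>y. \<Sum>i\<in>UNIV. y i *\<^sub>R (axis i 1 :: real ^ 'd)))"
    by (rule prob_space.prob_space_distr[OF prob_space_gauss_prod]) measurable
  then show ?thesis
    unfolding distr_gauss_prod_orthonormal[OF orth] .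
qed

section \<open>Proof of the deficit bound in the eigenbasis of the covariance\<close>

theorem theorem2:
  fixes \<mu> :: "(real ^ 'd) measure" and l :: "'d \<Rightarrow> real"
  assumes "prob_space \<mu>"
    and "sets \<mu> = sets borel"
    and "integrable \<mu> (\<lambda>x. (norm x)\<^sup>2)"
    and "mean \<mu> = 0"
    and "eigenvalue_enumeration (covariance_matrix \<mu>) l"
  shows "talagrand_deficit \<mu> \<ge> (\<Sum>i\<in>UNIV. deficit_term (l i))"
proof (cases "rel_entropy \<mu> std_gaussian = \<infinity>")
  case True
  then show ?thesis by (simp add: talagrand_deficit_def)
next
  case False
  let ?\<gamma> = "std_gaussian :: (real ^ 'd) measure" and ?N = "gauss_prod (UNIV :: 'd set)"
  interpret mu: prob_space \<mu> by fact
  interpret N: prob_space ?N by (rule prob_space_gauss_prod)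
  note [measurable_cong] = assms(2)
  obtain f where f [measurable]: "f \<in> borel_measurable ?\<gamma>" and f_nonneg: "\<And>x. 0 \<le> f x"
    and mu_eq: "\<mu> = density ?\<gamma> (\<lambda>x. ennreal (f x))"
    and f_ln: "integrable ?\<gamma> (\<lambda>x. f x * ln (f x))"
    and D: "rel_entropy \<mu> ?\<gamma> = ereal (\<integral>x. f x * ln (f x) \<partial>?\<gamma>)"
    using finite_rel_entropy_density[OF prob_space_std_gaussian assms(1) _ False] assms(2) by auto
  have f' [measurable]: "f \<in> borel_measurable borel"
    using f by (simp cong: measurable_cong_sets)
  have mu_integrable: "integrable \<mu> h \<longleftrightarrow> integrable ?\<gamma> (\<lambda>x. f x * h x)"
    and mu_integral: "(\<integral>x. h x \<partial>\<mu>) = (\<integral>x. f x * h x \<partial>?\<gamma>)"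
    if [measurable]: "h \<in> borel_measurable borel" for h :: "real ^ 'd \<Rightarrow> real"
    using f_nonneg by (subst mu_eq, subst integrable_density integral_density, auto)+
  have f_int: "integrable ?\<gamma> f" "(\<integral>x. f x \<partial>?\<gamma>) = 1"
    using mu_integrable[of "\<lambda>_. 1"] mu_integral[of "\<lambda>_. 1"] mu.prob_space by simp_all

  let ?A = "covariance_matrix \<mu>"
  have "transpose ?A = ?A"
    by (simp add: covariance_matrix_def transpose_def mult.commute vec_eq_iff)
  then obtain v :: "'d \<Rightarrow> real ^ 'd" and d where orth: "\<And>i j. v i \<bullet> v j = (if i = j then 1 else 0)"
    and eig: "\<And>i. ?A *v v i = d i *\<^sub>R v i"
    by (rule symmetric_matrix_spectral) (blast intro: that)
  have "(\<Prod>i\<in>UNIV. [:- l i, 1:]) = (\<Prod>i\<in>UNIV. [:- d i, 1:])"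
    using assms(5) char_polynomial_orthonormal_eigenbasis[OF orth eig] by (simp add: eigenvalue_enumeration_def)
  then have sum_eq: "(\<Sum>i\<in>UNIV. deficit_term (l i)) = (\<Sum>i\<in>UNIV. deficit_term (d i))"
    by (rule sum_over_roots_cong)
  have second: "integrable \<mu> (\<lambda>x. (v i \<bullet> x)\<^sup>2)" "(\<integral>x. (v i \<bullet> x)\<^sup>2 \<partial>\<mu>) = d i" for i
    using covariance_quadratic_form[OF assms(2-4), of "v i"] by (simp_all add: eig orth)
  have d_nonneg: "0 \<le> d i" for i
    unfolding second(2)[of i, symmetric] by simp

  \<comment> \<open>Coordinates in the eigenbasis: the Gaussian stays a product, and the second
    moments of the coordinates under \<open>\<mu>\<close> are the eigenvalues.\<close>
  define \<psi> :: "('d \<Rightarrow> real) \<Rightarrow> real ^ 'd" where "\<psi> y = (\<Sum>i\<in>UNIV. y i *\<^sub>R v i)" for y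
  have [measurable]: "\<psi> \<in> borel_measurable ?N"
    unfolding \<psi>_def by measurable
  have \<psi>_distr: "distr ?N borel \<psi> = ?\<gamma>"
    unfolding \<psi>_def by (rule distr_gauss_prod_orthonormal[OF orth])
  have \<psi>_coord: "v i \<bullet> \<psi> y = y i" for i y
    by (simp add: \<psi>_def inner_sum_right orth if_distrib cong: if_cong)
  have \<psi>_norm: "(norm (\<psi> y - \<psi> z))\<^sup>2 = (\<Sum>i\<in>UNIV. (y i - z i)\<^sup>2)" for y z
  proof -
    have "\<psi> y - \<psi> z = \<psi> (\<lambda>i. y i - z i)"
      by (simp add: \<psi>_def scaleR_diff_left sum_subtractf)
    then show ?thesis
      unfolding power2_norm_eq_inner
      by (simp add: \<psi>_coord \<psi>_def[of "\<lambda>i. y i - z i"] inner_sum_left power2_eq_square)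
        (simp add: \<psi>_def inner_sum_right orth if_distrib cong: if_cong)
  qed
  have pull_integrable: "integrable ?\<gamma> h \<longleftrightarrow> integrable ?N (\<lambda>y. h (\<psi> y))"
    and pull_integral: "(\<integral>x. h x \<partial>?\<gamma>) = (\<integral>y. h (\<psi> y) \<partial>?N)"
    if [measurable]: "h \<in> borel_measurable borel" for h :: "real ^ 'd \<Rightarrow> real"
    unfolding \<psi>_distr[symmetric] by (simp_all add: integrable_distr_eq integral_distr)

  define g where "g y = f (\<psi> y)" for y
  have g_meas [measurable]: "g \<in> borel_measurable ?N"
    unfolding g_def by measurable
  have g_nonneg: "0 \<le> g y" for y by (simp add: g_def f_nonneg)
  have g_int: "integrable ?N g" "(\<integral>y. g y \<partial>?N) = 1"
    using f_int by (simp_all add: pull_integrable pull_integral g_def[abs_def])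
  have g_ln: "integrable ?N (\<lambda>y. g y * ln (g y))" "(\<integral>y. g y * ln (g y) \<partial>?N) = (\<integral>x. f x * ln (f x) \<partial>?\<gamma>)"
    using f_ln by (simp_all add: pull_integrable pull_integral g_def)
  \<comment> \<open>Since \<open>g\<close> has integral 1, the terms \<open>- t + 1\<close> of
    \<open>ent_fn\<close> integrate to 0 and the relative entropy remains.\<close>
  have g_ent: "integrable ?N (\<lambda>y. ent_fn (g y))" "(\<integral>y. ent_fn (g y) \<partial>?N) = (\<integral>x. f x * ln (f x) \<partial>?\<gamma>)"
    using g_int g_ln N.prob_space by (simp_all add: ent_fn_def)
  have g_sq: "integrable ?N (\<lambda>y. g y * (y i)\<^sup>2)" "(\<integral>y. g y * (y i)\<^sup>2 \<partial>?N) = d i" for i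
    using second[of i] by (simp_all add: mu_integrable mu_integral pull_integrable pull_integral \<psi>_coord g_def)
  from triangular_transport[OF finite_class.finite_UNIV g_meas g_nonneg g_int g_ent(1) g_sq(1)]
  obtain S where S [measurable]: "S \<in> measurable ?N ?N"
    and transport': "\<forall>u\<in>borel_measurable ?N. (\<integral>\<^sup>+y. ennreal (g y) * u (S y) \<partial>?N) = (\<integral>\<^sup>+y. u y \<partial>?N)"
    and entropy': "\<forall>c. (\<forall>i\<in>UNIV. 0 < c i) \<longrightarrow>
      (\<Sum>i\<in>UNIV. (\<integral>y. g y * (y i)\<^sup>2 \<partial>?N) / 2 + 1 / 2 - ln (c i) - (\<integral>y. g y * (y i * S y i) \<partial>?N) / c i)
        \<le> (\<integral>y. ent_fn (g y) \<partial>?N)"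
    by (elim bexE conjE)
  have transport: "(\<integral>\<^sup>+y. ennreal (g y) * u (S y) \<partial>?N) = (\<integral>\<^sup>+y. u y \<partial>?N)"
    if "u \<in> borel_measurable ?N" for u
    using transport' that by (rule bspec)
  have entropy: "(\<Sum>i\<in>UNIV. d i / 2 + 1 / 2 - ln (c i) - (\<integral>y. g y * (y i * S y i) \<partial>?N) / c i)
      \<le> (\<integral>x. f x * ln (f x) \<partial>?\<gamma>)" if "\<And>i. 0 < c i" for c
    using entropy'[rule_format, of c] that unfolding g_sq(2) g_ent(2) by blast
  have S_sq: "integrable ?N (\<lambda>y. g y * (S y i)\<^sup>2)" "(\<integral>y. g y * (S y i)\<^sup>2 \<partial>?N) = 1" for i
    using transported_sq[OF finite_class.finite_UNIV UNIV_I g_meas S g_nonneg transport] by auto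
  define a where "a i = (\<integral>y. g y * (y i * S y i) \<partial>?N)" for i
  have cross: "integrable ?N (\<lambda>y. g y * (y i * S y i))" for i
  proof (rule integrable_weighted_product)
    show coord: "(\<lambda>y. y i) \<in> borel_measurable ?N"
      by measurable
    show "(\<lambda>y. S y i) \<in> borel_measurable ?N"
      by (rule measurable_compose[OF S coord])
  qed (use g_nonneg g_sq S_sq in auto)
  \<comment> \<open>The parameter \<open>t\<close> serves two purposes: \<open>t = 1\<close> gives
    the transport cost, general \<open>t\<close> gives Cauchy-Schwarz.\<close>
  have diff_eq: "g y * (y i - t * S y i)\<^sup>2 = g y * (y i)\<^sup>2 + t\<^sup>2 * (g y * (S y i)\<^sup>2) - 2 * t * (g y * (y i * S y i))" for y i t
    by (simp add: power2_eq_square algebra_simps)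
  have diff: "integrable ?N (\<lambda>y. g y * (y i - t * S y i)\<^sup>2)"
    "(\<integral>y. g y * (y i - t * S y i)\<^sup>2 \<partial>?N) = d i + t\<^sup>2 - 2 * t * a i" for i t
    unfolding diff_eq using g_sq[of i] S_sq[of i] cross[of i] by (simp_all add: a_def)
  have a_le: "a i \<le> sqrt (d i)" for i
  proof (rule field_le_epsilon)
    fix e :: real assume "0 < e"
    \<comment> \<open>Nonnegativity of \<open>d i + t\<^sup>2 - 2 * t * a i\<close> is wanted at
      \<open>t = sqrt (d i)\<close>; adding \<open>e\<close> keeps \<open>t\<close> positive when
      \<open>d i = 0\<close>.\<close>
    define t where "t = sqrt (d i) + e"
    have "0 < t"
      using \<open>0 < e\<close> d_nonneg[of i] by (simp add: t_def add_nonneg_pos)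
    have "sqrt (d i) * sqrt (d i) \<le> t * t"
      using \<open>0 < e\<close> d_nonneg[of i] by (intro mult_mono) (auto simp: t_def)
    then have "d i \<le> t * t"
      using d_nonneg[of i] by simp
    have "0 \<le> d i + t\<^sup>2 - 2 * t * a i"
      unfolding diff(2)[symmetric] using g_nonneg by simp
    then have "t * a i \<le> t * t"
      using \<open>d i \<le> t * t\<close> by (simp add: power2_eq_square)
    then show "a i \<le> sqrt (d i) + e"
      using \<open>0 < t\<close> by (simp add: t_def)
  qed

  define P where "P = density ?N (\<lambda>y. ennreal (g y))"
  have [measurable_cong]: "sets P = sets ?N" by (simp add: P_def)
  have P_mu: "distr P borel \<psi> = \<mu>"
    unfolding P_def g_def mu_eq \<psi>_distr[symmetric] by (rule density_distr[symmetric]) auto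
  have "prob_space P"
    by (rule prob_spaceI) (use g_int g_nonneg in \<open>simp add: P_def emeasure_density nn_integral_eq_integral\<close>)
  have P_gauss: "distr P borel (\<lambda>y. \<psi> (S y)) = ?\<gamma>"
  proof (rule measure_eqI)
    fix X assume "X \<in> sets (distr P borel (\<lambda>y. \<psi> (S y)))"
    then have [measurable]: "X \<in> sets borel" by simp
    have "emeasure (distr P borel (\<lambda>y. \<psi> (S y))) X = (\<integral>\<^sup>+x. indicator X x \<partial>distr P borel (\<lambda>y. \<psi> (S y)))"
      by simp
    also have "\<dots> = (\<integral>\<^sup>+y. indicator X (\<psi> (S y)) \<partial>P)"
      by (rule nn_integral_distr) auto
    also have "\<dots> = (\<integral>\<^sup>+y. ennreal (g y) * indicator X (\<psi> (S y)) \<partial>?N)"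
      unfolding P_def by (rule nn_integral_density) auto
    also have "\<dots> = (\<integral>\<^sup>+y. indicator X (\<psi> y) \<partial>?N)"
      by (rule transport) measurable
    also have "\<dots> = (\<integral>\<^sup>+x. indicator X x \<partial>?\<gamma>)"
      unfolding \<psi>_distr[symmetric] by (rule nn_integral_distr[symmetric]) auto
    finally show "emeasure (distr P borel (\<lambda>y. \<psi> (S y))) X = emeasure ?\<gamma> X"
      by simp
  qed simp
  \<comment> \<open>The cost of the triangular coupling, an upper bound for the squared Wasserstein
    distance.\<close>
  define K where "K = (\<Sum>i\<in>UNIV. d i + 1 - 2 * a i)"
  have term_eq: "g y * (norm (\<psi> y - \<psi> (S y)))\<^sup>2 = (\<Sum>i\<in>UNIV. g y * (y i - 1 * S y i)\<^sup>2)" for y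
    by (simp add: \<psi>_norm sum_distrib_left)
  have cost_int: "integrable ?N (\<lambda>y. g y * (norm (\<psi> y - \<psi> (S y)))\<^sup>2)"
    "(\<integral>y. g y * (norm (\<psi> y - \<psi> (S y)))\<^sup>2 \<partial>?N) = K"
    unfolding term_eq using diff(1)[of _ 1] diff(2)[of _ 1] by (simp_all add: K_def)
  have "transport_cost \<mu> ?\<gamma> \<le> (\<integral>\<^sup>+y. ennreal ((norm (\<psi> y - \<psi> (S y)))\<^sup>2) \<partial>P)"
    by (rule transport_cost_le[OF \<open>prob_space P\<close> _ _ P_mu P_gauss]) measurable
  also have "\<dots> = (\<integral>\<^sup>+y. ennreal (g y) * ennreal ((norm (\<psi> y - \<psi> (S y)))\<^sup>2) \<partial>?N)"
    unfolding P_def by (rule nn_integral_density) measurable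
  also have "\<dots> = (\<integral>\<^sup>+y. ennreal (g y * (norm (\<psi> y - \<psi> (S y)))\<^sup>2) \<partial>?N)"
    by (simp add: ennreal_mult g_nonneg)
  also have "\<dots> = ennreal K"
    using cost_int g_nonneg by (subst nn_integral_eq_integral) auto
  finally have cost: "transport_cost \<mu> ?\<gamma> \<le> ennreal K" .
  have "0 \<le> K"
    unfolding cost_int(2)[symmetric] using g_nonneg by simp
  with cost obtain W where W: "(wasserstein2 \<mu> ?\<gamma>)\<^sup>2 = ereal W" "W \<le> K"
    by (rule wasserstein2_sq_le)
  define V where "V = 2 * (\<integral>x. f x * ln (f x) \<partial>?\<gamma>) - K"
  have "(\<Sum>i\<in>UNIV. deficit_term (d i)) \<le> ereal V"
  proof (rule sum_deficit_term_le[OF d_nonneg a_le])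
    fix c :: "'d \<Rightarrow> real" assume "\<And>i. 0 < c i"
    from entropy[OF this]
    have "2 * (\<Sum>i\<in>UNIV. d i / 2 + 1 / 2 - ln (c i) - a i / c i) - K \<le> V"
      by (simp add: V_def a_def)
    \<comment> \<open>The contributions \<open>d i + 1\<close> of the entropy bound and of the cost
      cancel, so only the cross moments and the logarithms of \<open>c\<close> survive.\<close>
    also have "2 * (\<Sum>i\<in>UNIV. d i / 2 + 1 / 2 - ln (c i) - a i / c i) - K
        = (\<Sum>i\<in>UNIV. 2 * a i * (1 - 1 / c i) - 2 * ln (c i))"
      unfolding K_def sum_distrib_left sum_subtractf[symmetric]
      by (rule sum.cong) (simp_all add: algebra_simps)
    finally show "(\<Sum>i\<in>UNIV. 2 * a i * (1 - 1 / c i) - 2 * ln (c i)) \<le> V" .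
  qed
  also have "ereal V \<le> talagrand_deficit \<mu>"
    using W by (simp add: talagrand_deficit_def D V_def)
  finally show ?thesis
    unfolding sum_eq .
qed

end
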